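(* Let $\alpha$ be a probability distribution on $[d]$ with $\alpha_1\ge\cdots\ge\alpha_d$, let $n\in\mathbb N$, $k\in[d]$, and $\lambda\sim\mathrm{SW}^n(\alpha)$. Then \[ \mathbb E\big[(\lambda_k-\alpha_k n)^2\big]\le 42\,\alpha_k k\, n+42\,(\alpha_k+\alpha_{k+1}+\cdots+\alpha_d)\,n . \] Consequently $\mathbb E[(\lambda_k-\alpha_kn)^2]\le O(\min\{1,\alpha_kd\}\,n)$.
   Context: For a word $w\in[d]^n$, $\mathrm{shRSK}(w)$ denotes the RSK shape: the Young diagram $\lambda_1\ge\cdots\ge\lambda_d\ge0$ with $\sum\lambda_i=n$ such that $\lambda_1+\cdots+\lambda_k$ equals the maximum total length of a union of $k$ disjoint weakly increasing subsequences of $w$ (Greene's theorem). $\mathrm{SW}^n(\alpha)$ is the law of $\mathrm{shRSK}(\boldsymbol w)$ for $\boldsymbol w\in[d]^n$ with i.i.d. letters distributed as $\alpha$. *)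

theory Defs
  imports Complex_Main
begin

definition weakly_incr_idx :: "nat list \<Rightarrow> nat set \<Rightarrow> bool" where
  "weakly_incr_idx w S \<longleftrightarrow>
     S \<subseteq> {..<length w} \<and> (\<forall>i\<in>S. \<forall>j\<in>S. i \<le> j \<longrightarrow> w ! i \<le> w ! j)"

definition greene :: "nat \<Rightarrow> nat list \<Rightarrow> nat" where
  "greene k w = Max {card (\<Union> (set Ss)) | Ss.
      length Ss = k \<and> (\<forall>S\<in>set Ss. weakly_incr_idx w S) \<and>
      (\<forall>i<k. \<forall>j<k. i \<noteq> j \<longrightarrow> Ss ! i \<inter> Ss ! j = {})}"

text \<open>The k-th row (k \<ge> 1) of the RSK shape, determined by Greene's theorem:
  lambda_1 + ... + lambda_k = greene k w.\<close>

definition shRSK :: "nat list \<Rightarrow> nat \<Rightarrow> nat" where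
  "shRSK w k = greene k w - greene (k - 1) w"

definition words :: "nat \<Rightarrow> nat \<Rightarrow> nat list set" where
  "words d n = {w. length w = n \<and> set w \<subseteq> {1..d}}"

text \<open>Expectation of F(w) for a random word w in [d]^n with i.i.d. letters of law alpha;
  in particular SW_expect d alpha n (\<lambda>w. f (shRSK w)) is E[f(lambda)], lambda ~ SW^n(alpha).\<close>

definition word_expect :: "nat \<Rightarrow> (nat \<Rightarrow> real) \<Rightarrow> nat \<Rightarrow> (nat list \<Rightarrow> real) \<Rightarrow> real" where
  "word_expect d \<alpha> n F = (\<Sum>w\<in>words d n. (\<Prod>i<n. \<alpha> (w ! i)) * F w)"

definition prob_dist_sorted :: "nat \<Rightarrow> (nat \<Rightarrow> real) \<Rightarrow> bool" where
  "prob_dist_sorted d \<alpha> \<longleftrightarrow>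
     (\<forall>i\<in>{1..d}. \<alpha> i \<ge> 0) \<and> (\<Sum>i=1..d. \<alpha> i) = 1 \<and>
     (\<forall>i\<in>{1..d}. \<forall>j\<in>{1..d}. i \<le> j \<longrightarrow> \<alpha> j \<le> \<alpha> i)"

end

(* With Greene's definition, lambda_k is at most the number of hits of the word with some weakly
   increasing path of letters >= k, and at least the number of hits with some weakly decreasing path
   of letters in {1..k}.  The maximal (minimal) number of hits is computed by a system of queues:
   row insertion for the upper bound, queues in series for the lower bound.  Started from independent
   geometric queue lengths these systems are stationary, and their output process is i.i.d. (Burke's
   theorem), so the count differs from a binomial variable by at most the initial queue content.
   To make the stationary law exist, the letter k is made slightly more (less) likely; choosing this
   perturbation of order sqrt(tail / n) (sqrt(k alpha_k / n)) gives second moments 32 tail n and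
   12 k alpha_k n for the positive and the negative part of lambda_k - alpha_k n. *)

theory Submission
  imports Defs "HOL-Probability.Probability"
begin

section \<open>Greene shapes and monotone paths\<close>

text \<open>The path supplied by Greene's definition depends on the whole word, so the law of the
  hits along a fixed path is of no use: the bounds must hold for all monotone paths of a word at
  once. A potential achieves this. Each letter is charged against the content of the queues that the
  path can still reach from its current value, and since the path is monotone this set of queues
  only shrinks. The obstacle is a tie: if \<open>\<alpha> i = \<alpha> k\<close>, then queue
  \<open>i\<close> is critical and has no stationary law. The word itself must keep its law, so the
  perturbation is a coupling: every letter carries an independent coin, and the effect of the coins
  on the hits is controlled for every path. If the tail times \<open>n\<close> is at most 1, or
  \<open>\<alpha> k * n\<close> is at most \<open>k\<close>, a perturbation of the stated order
  would not be smaller than the tail, respectively \<open>\<alpha> k\<close>; there a crude bound is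
  already good enough.\<close>

fun hits :: "nat list \<Rightarrow> (nat \<Rightarrow> nat) \<Rightarrow> nat" where
  "hits [] h = 0"
| "hits (y # ys) h = of_bool (y = h 0) + hits ys (\<lambda>t. h (Suc t))"

text \<open>The recursion shifts the path along with the word, which suits inductions over
  transducer runs; the cardinality is the form in which Greene's index sets enter.\<close>

lemma hits_eq_card: "hits w h = card {t. t < length w \<and> w ! t = h t}"
proof (induction w arbitrary: h)
  case Nil
  then show ?case by simp
next
  case (Cons y w)
  have "{t. t < length (y # w) \<and> (y # w) ! t = h t} =
      (if y = h 0 then {0} else {}) \<union> Suc ` {t. t < length w \<and> w ! t = h (Suc t)}"
    by (auto simp: image_iff less_Suc_eq_0_disj)
  also have "card \<dots> = of_bool (y = h 0) + card {t. t < length w \<and> w ! t = h (Suc t)}"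
    by (subst card_Un_disjoint) (auto simp: card_image)
  finally show ?case using Cons.IH by simp
qed

text \<open>Subsequences are encoded as total paths, ordered strictly at every time and not only
  where letters are hit. Disjointness of the hit positions is then automatic, and the paths are
  forced apart in value.\<close>

definition chain :: "(nat \<Rightarrow> nat) list \<Rightarrow> bool" where
  "chain hs \<longleftrightarrow> (\<forall>h\<in>set hs. mono h) \<and> sorted_wrt (\<lambda>h h'. \<forall>t. h t < h' t) hs"

text \<open>Bumping one mono path through a chain: wherever the two paths agree, the path that is passed
  on moves up by one, so that strictness is restored without losing a value.\<close>

fun ins_path :: "(nat \<Rightarrow> nat) \<Rightarrow> (nat \<Rightarrow> nat) list \<Rightarrow> (nat \<Rightarrow> nat) list" where
  "ins_path f [] = [f]"
| "ins_path f (h # hs) = (\<lambda>t. min (h t) (f t)) #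
     ins_path (\<lambda>t. max (max (h t) (f t)) (Suc (min (h t) (f t)))) hs"

text \<open>The least value \<open>\<ge> v\<close> not taken at time \<open>t\<close> by a chain with values \<open>\<ge> v\<close>. Bumping the constant
  path \<open>v\<close> through the chain adds exactly this value at every time.\<close>

fun gap :: "nat \<Rightarrow> (nat \<Rightarrow> nat) list \<Rightarrow> nat \<Rightarrow> nat" where
  "gap v [] t = v"
| "gap v (h # hs) t = (if h t = v then gap (Suc v) hs t else v)"

definition covered :: "nat list \<Rightarrow> (nat \<Rightarrow> nat) list \<Rightarrow> nat set" where
  "covered w hs = {t. t < length w \<and> (\<exists>h\<in>set hs. w ! t = h t)}"

section \<open>Bumping a path through a chain\<close>

lemma length_ins_path [simp]: "length (ins_path f hs) = Suc (length hs)"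
  by (induction f hs rule: ins_path.induct) auto

lemma ins_path_ge:
  assumes "\<forall>h\<in>set hs. b \<le> h t" "b \<le> f t" "h \<in> set (ins_path f hs)"
  shows "b \<le> h t"
  using assms by (induction f hs rule: ins_path.induct) auto

lemma ins_path_mono:
  assumes "\<forall>h\<in>set hs. mono h" "mono f" "h \<in> set (ins_path f hs)"
  shows "mono h"
  using assms
proof (induction f hs rule: ins_path.induct)
  case (2 f h' hs)
  have m: "mono h'" "mono f" using 2(2,3) by auto
  have "mono (\<lambda>t. min (h' t) (f t))"
    using m by (intro monoI min.mono) (auto dest: monoD)
  moreover have "mono (\<lambda>t. max (max (h' t) (f t)) (Suc (min (h' t) (f t))))"
    using m by (intro monoI max.mono min.mono iffD2[OF Suc_le_mono]) (auto dest: monoD)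
  ultimately show ?case using 2 by auto
qed auto

text \<open>The path passed on is at least \<open>Suc (min (h t) (f t))\<close>, and so is every
  later member, which exceeds \<open>h\<close>. Bumping keeps this lower bound, so the new head
  stays strictly below the whole new tail.\<close>

lemma chain_ins_path:
  assumes "chain hs" "mono f"
  shows "chain (ins_path f hs)"
proof -
  have "sorted_wrt (\<lambda>h h'. \<forall>t. h t < h' t) (ins_path f hs)"
    if "sorted_wrt (\<lambda>h h'. \<forall>t. h t < h' t) hs"
    using that
  proof (induction f hs rule: ins_path.induct)
    case (2 f h hs)
    have "min (h t) (f t) < h' t"
      if "h' \<in> set (ins_path (\<lambda>t. max (max (h t) (f t)) (Suc (min (h t) (f t)))) hs)" for h' t
    proof -
      have "Suc (min (h t) (f t)) \<le> h' t"
        using that 2(2) by (intro ins_path_ge[OF _ _ that]) (auto simp: Suc_le_eq min_less_iff_disj)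
      then show ?thesis by simp
    qed
    then show ?case using 2 by auto
  qed auto
  then show ?thesis using assms ins_path_mono unfolding chain_def by blast
qed

lemma ins_path_keeps:
  assumes "v = f t \<or> (\<exists>h\<in>set hs. v = h t)"
  shows "\<exists>h\<in>set (ins_path f hs). v = h t"
  using assms
proof (induction f hs rule: ins_path.induct)
  case (2 f h hs)
  show ?case
  proof (cases "v = min (h t) (f t)")
    case False
    then have "v = max (max (h t) (f t)) (Suc (min (h t) (f t))) \<or> (\<exists>h\<in>set hs. v = h t)"
      using 2(2) by (auto simp: min_def max_def split: if_splits)
    then show ?thesis using 2(1) by auto
  qed auto
qed auto

lemma gap_bounds: "v \<le> gap v hs t \<and> gap v hs t \<le> v + length hs"
proof (induction v hs t rule: gap.induct)
  case (2 v h hs t)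
  then show ?case by auto
qed auto

text \<open>If a member equals its lower bound \<open>v\<close> at time \<open>t\<close>,
  monotonicity forces it to equal \<open>v\<close> at all earlier times. The run of occupied values
  starting at \<open>v\<close> can therefore only get shorter as time passes.\<close>

lemma gap_antimono:
  assumes "chain hs" "\<forall>h\<in>set hs. \<forall>t. v \<le> h t" "s \<le> t"
  shows "gap v hs t \<le> gap v hs s"
  using assms
proof (induction hs arbitrary: v)
  case (Cons h hs)
  have c: "chain hs" "mono h" "\<forall>h'\<in>set hs. \<forall>t. h t < h' t"
    using Cons.prems(1) by (auto simp: chain_def)
  show ?case
  proof (cases "h t = v")
    case True
    have "h s = v"
      using monoD[OF c(2) Cons.prems(3)] Cons.prems(2) True
      by (metis antisym list.set_intros(1))
    moreover have "gap (Suc v) hs t \<le> gap (Suc v) hs s"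
    proof (rule Cons.IH[OF c(1) _ Cons.prems(3)])
      show "\<forall>h\<in>set hs. \<forall>t. Suc v \<le> h t"
        using c(3) Cons.prems(2) by (auto simp: Suc_le_eq intro: le_less_trans)
    qed
    ultimately show ?thesis using True by simp
  next
    case False
    then show ?thesis using gap_bounds[of v "h # hs" s] by simp
  qed
qed simp

lemma gap_not_in:
  assumes "chain hs" "\<forall>h\<in>set hs. v \<le> h t" "h \<in> set hs"
  shows "gap v hs t \<noteq> h t"
  using assms
proof (induction hs arbitrary: v)
  case (Cons h' hs)
  have c: "chain hs" "\<forall>h\<in>set hs. h' t < h t"
    using Cons.prems(1) by (auto simp: chain_def)
  show ?case
  proof (cases "h' t = v")
    case True
    then have "\<forall>h\<in>set hs. Suc v \<le> h t" using c(2) by (auto simp: Suc_le_eq)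
    then show ?thesis
      using Cons.IH[OF c(1), of "Suc v"] True Cons.prems(3) gap_bounds[of "Suc v" hs t] by auto
  next
    case False
    then have "v < h' t" using Cons.prems(2) by auto
    then show ?thesis using Cons.prems(3) c(2) False by (auto dest: less_trans)
  qed
qed simp

text \<open>Where \<open>f\<close> meets the head, \<open>Suc (f t)\<close> is passed on, exactly as
  in the recursion of \<open>gap\<close>; where it does not, \<open>f t\<close> itself stays as the
  minimum. A general \<open>f\<close> and a single time \<open>t\<close> are needed because a
  constant path need not stay constant after one bump.\<close>

lemma ins_path_gap:
  assumes "chain hs" "\<forall>h\<in>set hs. f t \<le> h t"
  shows "\<exists>h\<in>set (ins_path f hs). gap (f t) hs t = h t"
  using assms
proof (induction f hs rule: ins_path.induct)
  case (2 f h hs)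
  have c: "chain hs" "\<forall>h'\<in>set hs. h t < h' t"
    using 2(2) by (auto simp: chain_def)
  let ?f = "\<lambda>t. max (max (h t) (f t)) (Suc (min (h t) (f t)))"
  show ?case
  proof (cases "h t = f t")
    case True
    then have e: "?f t = Suc (f t)" by simp
    have "\<exists>h\<in>set (ins_path ?f hs). gap (?f t) hs t = h t"
      by (rule 2(1)[OF c(1)]) (use c(2) e True in \<open>auto simp: Suc_le_eq\<close>)
    then show ?thesis using True e by auto
  next
    case False
    then show ?thesis using 2(3) by auto
  qed
qed auto

lemma chain_nth_ge:
  assumes "chain hs" "\<forall>h\<in>set hs. 1 \<le> h t" "i < length hs"
  shows "Suc i \<le> (hs ! i) t"
  using assms(3)
proof (induction i)
  case 0
  then show ?case using assms(2) nth_mem by fastforce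
next
  case (Suc i)
  have "(hs ! i) t < (hs ! Suc i) t"
    using assms(1) Suc.prems sorted_wrt_nth_less[of "\<lambda>h h'. \<forall>t. h t < h' t" hs i "Suc i"]
    by (simp add: chain_def)
  then show ?case using Suc by simp
qed

section \<open>Greene's numbers in terms of chains\<close>

lemma covered_subset: "covered w hs \<subseteq> {..<length w}"
  by (auto simp: covered_def)

lemma finite_covered [simp]: "finite (covered w hs)"
  using covered_subset finite_subset by blast

lemma finite_greene_set:
  "finite {card (\<Union> (set Ss)) | Ss.
      length Ss = k \<and> (\<forall>S\<in>set Ss. weakly_incr_idx w S) \<and>
      (\<forall>i<k. \<forall>j<k. i \<noteq> j \<longrightarrow> Ss ! i \<inter> Ss ! j = {})}"
proof (rule finite_subset)
  show "finite {..length w}" by simp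
  show "{card (\<Union> (set Ss)) | Ss.
      length Ss = k \<and> (\<forall>S\<in>set Ss. weakly_incr_idx w S) \<and>
      (\<forall>i<k. \<forall>j<k. i \<noteq> j \<longrightarrow> Ss ! i \<inter> Ss ! j = {})} \<subseteq> {..length w}"
  proof clarsimp
    fix Ss assume "\<forall>S\<in>set Ss. weakly_incr_idx w S"
    then have "\<Union> (set Ss) \<subseteq> {..<length w}" by (auto simp: weakly_incr_idx_def)
    from card_mono[OF _ this] show "card (\<Union> (set Ss)) \<le> length w" by simp
  qed
qed

text \<open>The hit sets of the members form an admissible family: monotone paths select weakly
  increasing letters, and strict order makes the sets disjoint.\<close>

lemma covered_le_greene:
  assumes "chain hs"
  shows "card (covered w hs) \<le> greene (length hs) w"
  unfolding greene_def
proof (rule Max_ge[OF finite_greene_set], rule CollectI, intro exI conjI)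
  let ?Ss = "map (\<lambda>h. {t. t < length w \<and> w ! t = h t}) hs"
  show "card (covered w hs) = card (\<Union> (set ?Ss))"
    by (rule arg_cong[where f = card]) (auto simp: covered_def)
  show "length ?Ss = length hs" by simp
  show "\<forall>S\<in>set ?Ss. weakly_incr_idx w S"
    using assms by (auto simp: weakly_incr_idx_def chain_def mono_def)
  have "(hs ! i) t \<noteq> (hs ! j) t" if "i < length hs" "j < length hs" "i < j" for i j t
    using assms that sorted_wrt_nth_less[of "\<lambda>h h'. \<forall>t. h t < h' t" hs i j]
    by (auto simp: chain_def nat_neq_iff)
  then have "(hs ! i) t \<noteq> (hs ! j) t" if "i < length hs" "j < length hs" "i \<noteq> j" for i j t
    using that by (metis linorder_neqE_nat)
  then show "\<forall>i<length hs. \<forall>j<length hs. i \<noteq> j \<longrightarrow> ?Ss ! i \<inter> ?Ss ! j = {}"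
    by (auto)
qed

text \<open>The running maximum of the selected letters. The inserted 1 is the value before the
  first selected position and cannot exceed a selected letter, as letters are at least 1.\<close>

definition path_through :: "nat list \<Rightarrow> nat set \<Rightarrow> nat \<Rightarrow> nat" where
  "path_through w S t = Max (insert 1 {w ! i | i. i \<in> S \<and> i \<le> t})"

lemma path_through:
  assumes "weakly_incr_idx w S" "\<forall>x\<in>set w. 1 \<le> x"
  shows "mono (path_through w S)" "1 \<le> path_through w S t"
    and "t \<in> S \<Longrightarrow> path_through w S t = w ! t"
proof -
  have fin: "finite {w ! i | i. i \<in> S \<and> i \<le> t}" for t
    by simp
  show "mono (path_through w S)"
    unfolding path_through_def by (rule monoI, rule Max_mono) (auto intro: order_trans)
  show "1 \<le> path_through w S t"
    unfolding path_through_def using fin by (intro Max_ge) auto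
  assume t: "t \<in> S"
  then have "t < length w" using assms(1) by (auto simp: weakly_incr_idx_def)
  then have "1 \<le> w ! t" using assms(2) by auto
  then show "path_through w S t = w ! t"
    unfolding path_through_def using t assms(1) fin
    by (intro Max_eqI) (auto simp: weakly_incr_idx_def)
qed

text \<open>An optimal family is turned into running maxima, which are bumped one by one into an
  initially empty chain. Bumping loses no value, so every selected position remains covered.\<close>

lemma greene_le_covered:
  assumes "\<forall>x\<in>set w. 1 \<le> x"
  obtains hs where "chain hs" "length hs = k" "\<forall>h\<in>set hs. \<forall>t. 1 \<le> h t"
    "greene k w \<le> card (covered w hs)"
proof -
  let ?G = "{card (\<Union> (set Ss)) | Ss.
      length Ss = k \<and> (\<forall>S\<in>set Ss. weakly_incr_idx w S) \<and>
      (\<forall>i<k. \<forall>j<k. i \<noteq> j \<longrightarrow> Ss ! i \<inter> Ss ! j = {})}"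
  \<comment> \<open>A family of empty sets shows that the maximum ranges over a nonempty set and is
    thus attained.\<close>
  have "card (\<Union> (set (replicate k ({} :: nat set)))) \<in> ?G"
    by (rule CollectI, rule exI[of _ "replicate k {}"]) (auto simp: weakly_incr_idx_def)
  then have "greene k w \<in> ?G"
    unfolding greene_def by (intro Max_in[OF finite_greene_set]) blast
  then obtain Ss where Ss: "length Ss = k" "\<forall>S\<in>set Ss. weakly_incr_idx w S"
    "greene k w = card (\<Union> (set Ss))" by auto
  define hs where "hs = foldr (\<lambda>S. ins_path (path_through w S)) Ss []"
  have "length (foldr (\<lambda>S. ins_path (path_through w S)) Ss []) = length Ss \<and>
      chain (foldr (\<lambda>S. ins_path (path_through w S)) Ss []) \<and>
      (\<forall>h\<in>set (foldr (\<lambda>S. ins_path (path_through w S)) Ss []). \<forall>t. 1 \<le> h t) \<and>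
      \<Union> (set Ss) \<subseteq> covered w (foldr (\<lambda>S. ins_path (path_through w S)) Ss [])"
    using Ss(2)
  proof (induction Ss)
    case Nil
    then show ?case by (simp add: chain_def)
  next
    case (Cons S Ss)
    let ?hs = "foldr (\<lambda>S. ins_path (path_through w S)) Ss []"
    have IH: "length ?hs = length Ss" "chain ?hs" "\<forall>h\<in>set ?hs. \<forall>t. 1 \<le> h t"
      "\<Union> (set Ss) \<subseteq> covered w ?hs" using Cons by auto
    have S: "weakly_incr_idx w S" using Cons.prems by simp
    note p = path_through[OF S assms]
    have "S \<subseteq> covered w (ins_path (path_through w S) ?hs)"
    proof
      fix t assume t: "t \<in> S"
      then have "t < length w" using S by (auto simp: weakly_incr_idx_def)
      moreover have "\<exists>h\<in>set (ins_path (path_through w S) ?hs). w ! t = h t"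
        using p(3)[OF t] by (intro ins_path_keeps) simp
      ultimately show "t \<in> covered w (ins_path (path_through w S) ?hs)"
        by (simp add: covered_def)
    qed
    moreover have "covered w ?hs \<subseteq> covered w (ins_path (path_through w S) ?hs)"
      using ins_path_keeps[of _ "path_through w S" _ ?hs] by (force simp: covered_def)
    moreover have "\<forall>h\<in>set (ins_path (path_through w S) ?hs). \<forall>t. 1 \<le> h t"
      using ins_path_ge[of ?hs 1 _ "path_through w S"] IH(3) p(2) by blast
    ultimately show ?case
      using IH chain_ins_path[OF IH(2) p(1)] by auto
  qed
  then have "length hs = k" "chain hs" "\<forall>h\<in>set hs. \<forall>t. 1 \<le> h t" "\<Union> (set Ss) \<subseteq> covered w hs"
    using Ss(1) by (auto simp: hs_def)
  then show thesis
    using that[of hs] Ss(3) card_mono[of "covered w hs" "\<Union> (set Ss)"] by simp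
qed

text \<open>The last of \<open>k\<close> strictly ordered paths only uses letters \<open>\<ge> k\<close>; removing it leaves \<open>k - 1\<close> paths.\<close>

lemma shRSK_upper:
  assumes "\<forall>x\<in>set w. 1 \<le> x" "1 \<le> k"
  obtains h where "mono h" "\<forall>t. k \<le> h t" "shRSK w k \<le> hits w h"
proof -
  obtain hs where hs: "chain hs" "length hs = k" "\<forall>h\<in>set hs. \<forall>t. 1 \<le> h t"
    "greene k w \<le> card (covered w hs)" using greene_le_covered[OF assms(1)] by blast
  have ne: "hs \<noteq> []" using hs(2) assms(2) by auto
  then have split: "hs = butlast hs @ [last hs]" by simp
  have "set hs = insert (last hs) (set (butlast hs))"
    by (subst split) (simp del: append_butlast_last_id)
  then have "covered w hs = covered w (butlast hs) \<union> {t. t < length w \<and> w ! t = last hs t}"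
    by (auto simp: covered_def)
  then have "card (covered w hs) \<le> card (covered w (butlast hs)) + hits w (last hs)"
    by (simp add: hits_eq_card card_Un_le)
  moreover have "chain (butlast hs)"
  proof -
    have "chain (butlast hs @ [last hs])" using hs(1) ne by simp
    then show ?thesis unfolding chain_def sorted_wrt_append by auto
  qed
  then have "card (covered w (butlast hs)) \<le> greene (k - 1) w"
    using covered_le_greene hs(2) by fastforce
  ultimately have "shRSK w k \<le> hits w (last hs)"
    using hs(4) by (simp add: shRSK_def)
  moreover have "k \<le> last hs t" for t
    using chain_nth_ge[OF hs(1), of t "k - 1"] hs(2,3) assms(2) ne by (simp add: last_conv_nth)
  moreover have "mono (last hs)" using hs(1) ne by (simp add: chain_def)
  ultimately show thesis using that by blast
qed

text \<open>An optimal chain of \<open>k - 1\<close> paths is enlarged by bumping in the constant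
  path 1. The positions hit by the gap path were not covered before and are covered afterwards, so
  the Greene number grows by at least their count.\<close>

lemma shRSK_lower:
  assumes "\<forall>x\<in>set w. 1 \<le> x" "1 \<le> k"
  obtains g where "antimono g" "\<forall>t. 1 \<le> g t \<and> g t \<le> k" "hits w g \<le> shRSK w k"
proof -
  obtain hs where hs: "chain hs" "length hs = k - 1" "\<forall>h\<in>set hs. \<forall>t. 1 \<le> h t"
    "greene (k - 1) w \<le> card (covered w hs)" using greene_le_covered[OF assms(1)] by blast
  define g where "g = gap 1 hs"
  define hs' where "hs' = ins_path (\<lambda>_. 1) hs"
  let ?B = "{t. t < length w \<and> w ! t = g t}"
  have "chain hs'" unfolding hs'_def by (rule chain_ins_path[OF hs(1)]) (simp add: mono_def)
  then have "card (covered w hs') \<le> greene k w"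
    using covered_le_greene[of hs' w] hs(2) assms(2) by (simp add: hs'_def)
  moreover have "covered w hs \<union> ?B \<subseteq> covered w hs'"
  proof -
    have "covered w hs \<subseteq> covered w hs'"
      using ins_path_keeps[of _ "\<lambda>_. 1" _ hs] by (force simp: covered_def hs'_def)
    moreover have "\<exists>h\<in>set hs'. g t = h t" for t
      using ins_path_gap[OF hs(1), of "\<lambda>_. 1" t] hs(3) by (simp add: g_def hs'_def)
    ultimately show ?thesis by (auto simp: covered_def)
  qed
  then have "card (covered w hs \<union> ?B) \<le> card (covered w hs')"
    by (intro card_mono) auto
  moreover have "covered w hs \<inter> ?B = {}"
    using gap_not_in[OF hs(1), of 1] hs(3) by (fastforce simp: covered_def g_def)
  then have "card (covered w hs \<union> ?B) = card (covered w hs) + hits w g"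
    by (simp add: card_Un_disjoint hits_eq_card)
  ultimately have "hits w g \<le> shRSK w k"
    using hs(4) by (simp add: shRSK_def)
  moreover have "antimono g"
    using gap_antimono[OF hs(1), of 1] hs(3) by (auto simp: antimono_def g_def)
  moreover have "1 \<le> g t \<and> g t \<le> k" for t
    using gap_bounds[of 1 hs t] hs(2) assms(2) by (simp add: g_def)
  ultimately show thesis using that by blast
qed

section \<open>Second moments and measure-preserving transducers\<close>

text \<open>Mean \<open>m\<close> and variance \<open>v\<close>, stated with extended nonnegative integrals so that no separate
  integrability conditions are needed.\<close>

definition moments :: "'a pmf \<Rightarrow> ('a \<Rightarrow> nat) \<Rightarrow> real \<Rightarrow> real \<Rightarrow> bool" where
  "moments M X m v \<longleftrightarrow> 0 \<le> m \<and> 0 \<le> v \<and>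
     (\<integral>\<^sup>+x. ennreal (real (X x)) \<partial>measure_pmf M) = ennreal m \<and>
     (\<integral>\<^sup>+x. ennreal ((real (X x))\<^sup>2) \<partial>measure_pmf M) = ennreal (m\<^sup>2 + v)"

lemma moments_pair:
  assumes "moments M f m v" "moments N g m' v'"
  shows "moments (pair_pmf M N) (\<lambda>(a, b). f a + g b) (m + m') (v + v')"
proof -
  have 1: "(\<integral>\<^sup>+x. ennreal (real (case x of (a, b) \<Rightarrow> f a + g b)) \<partial>pair_pmf M N) = ennreal (m + m')"
    using assms by (simp add: moments_def nn_integral_pair_pmf' nn_integral_add ennreal_plus)
  have "(\<integral>\<^sup>+x. ennreal ((real (case x of (a, b) \<Rightarrow> f a + g b))\<^sup>2) \<partial>pair_pmf M N) =
      (\<integral>\<^sup>+a. \<integral>\<^sup>+b. ennreal ((real (f a))\<^sup>2) + (ennreal (2 * real (f a)) * ennreal (real (g b)) +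
         ennreal ((real (g b))\<^sup>2)) \<partial>N \<partial>M)"
    by (simp add: nn_integral_pair_pmf' power2_sum flip: ennreal_plus ennreal_mult)
       (simp add: algebra_simps)
  also have "\<dots> = (\<integral>\<^sup>+a. ennreal ((real (f a))\<^sup>2) + (ennreal (2 * m') * ennreal (real (f a)) +
         ennreal (m'\<^sup>2 + v')) \<partial>M)"
  proof (intro nn_integral_cong)
    fix a
    have "(\<integral>\<^sup>+b. ennreal ((real (f a))\<^sup>2) + (ennreal (2 * real (f a)) * ennreal (real (g b)) +
         ennreal ((real (g b))\<^sup>2)) \<partial>N) =
      ennreal ((real (f a))\<^sup>2) + (ennreal (2 * real (f a)) * ennreal m' + ennreal (m'\<^sup>2 + v'))"
      using assms by (simp add: moments_def nn_integral_add nn_integral_cmult)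
    also have "ennreal (2 * real (f a)) * ennreal m' = ennreal (2 * m') * ennreal (real (f a))"
      using assms by (simp add: moments_def mult_ac flip: ennreal_mult)
    finally show "(\<integral>\<^sup>+b. ennreal ((real (f a))\<^sup>2) + (ennreal (2 * real (f a)) * ennreal (real (g b)) +
         ennreal ((real (g b))\<^sup>2)) \<partial>N) =
      ennreal ((real (f a))\<^sup>2) + (ennreal (2 * m') * ennreal (real (f a)) + ennreal (m'\<^sup>2 + v'))" .
  qed
  also have "\<dots> = ennreal (m\<^sup>2 + v) + (ennreal (2 * m') * ennreal m + ennreal (m'\<^sup>2 + v'))"
    using assms by (simp add: moments_def nn_integral_add nn_integral_cmult)
  also have "\<dots> = ennreal ((m + m')\<^sup>2 + (v + v'))"
    using assms by (simp add: moments_def power2_sum algebra_simps flip: ennreal_plus ennreal_mult)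
  finally show ?thesis using 1 assms by (simp add: moments_def)
qed

lemma moments_map: "moments (map_pmf f M) X m v \<longleftrightarrow> moments M (\<lambda>x. X (f x)) m v"
  by (simp add: moments_def)

text \<open>The cross term \<open>2 * m * X\<close> is carried on the left side, since extended
  nonnegative reals allow no free subtraction; a finite constant is cancelled at the end.\<close>

lemma moments_centered:
  assumes "moments M X m v"
  shows "(\<integral>\<^sup>+x. ennreal ((real (X x) - m)\<^sup>2) \<partial>measure_pmf M) = ennreal v"
proof -
  have nn: "0 \<le> m" "0 \<le> v" using assms by (auto simp: moments_def)
  have "(\<integral>\<^sup>+x. ennreal ((real (X x) - m)\<^sup>2) \<partial>measure_pmf M) + ennreal (2 * m * m) =
      (\<integral>\<^sup>+x. ennreal ((real (X x) - m)\<^sup>2) + ennreal (2 * m) * ennreal (real (X x)) \<partial>measure_pmf M)"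
    using assms nn by (simp add: moments_def nn_integral_add nn_integral_cmult ennreal_mult)
  also have "\<dots> = (\<integral>\<^sup>+x. ennreal ((real (X x))\<^sup>2) + ennreal (m\<^sup>2) \<partial>measure_pmf M)"
  proof (intro nn_integral_cong)
    fix x
    have "ennreal ((real (X x) - m)\<^sup>2) + ennreal (2 * m) * ennreal (real (X x)) =
        ennreal ((real (X x) - m)\<^sup>2 + 2 * m * real (X x))"
      using nn by (simp flip: ennreal_plus ennreal_mult)
    also have "(real (X x) - m)\<^sup>2 + 2 * m * real (X x) = (real (X x))\<^sup>2 + m\<^sup>2"
      by (simp add: power2_diff)
    finally show "ennreal ((real (X x) - m)\<^sup>2) + ennreal (2 * m) * ennreal (real (X x)) =
        ennreal ((real (X x))\<^sup>2) + ennreal (m\<^sup>2)" by (simp add: ennreal_plus)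
  qed
  also have "\<dots> = ennreal (m\<^sup>2 + v) + ennreal (m\<^sup>2)"
    using assms by (simp add: moments_def nn_integral_add)
  also have "\<dots> = ennreal v + ennreal (2 * m * m)"
    using nn by (simp add: power2_eq_square flip: ennreal_plus)
  finally show ?thesis
    by (simp add: add.commute[of _ "ennreal (2 * m * m)"] ennreal_add_left_cancel)
qed

lemma moments_indicator:
  "moments p (\<lambda>x. of_bool (Q x)) (measure_pmf.prob p {x. Q x})
     (measure_pmf.prob p {x. Q x} * (1 - measure_pmf.prob p {x. Q x}))"
proof -
  have "(\<integral>\<^sup>+x. ennreal (of_bool (Q x)) \<partial>measure_pmf p) = (\<integral>\<^sup>+x. indicator {x. Q x} x \<partial>measure_pmf p)"
    by (intro nn_integral_cong) (auto simp: indicator_def)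
  also have "\<dots> = ennreal (measure_pmf.prob p {x. Q x})"
    by (simp add: measure_pmf.emeasure_eq_measure)
  finally show ?thesis
    by (simp add: moments_def mult_left_le of_bool_def if_distrib if_distribR algebra_simps power2_eq_square cong: if_cong)
qed

section \<open>Moments of independent letters and of geometric laws\<close>

lemma replicate_pmf_Suc:
  "replicate_pmf (Suc n) p = map_pmf (\<lambda>(x, xs). x # xs) (pair_pmf p (replicate_pmf n p))"
  by (simp add: pair_pmf_def map_bind_pmf map_pmf_def bind_assoc_pmf bind_return_pmf)

lemma replicate_map_pmf: "replicate_pmf n (map_pmf f p) = map_pmf (map f) (replicate_pmf n p)"
  by (induction n) (simp_all add: map_pmf_def bind_assoc_pmf bind_return_pmf)

lemma moments_count:
  "moments (replicate_pmf n p) (\<lambda>xs. length (filter Q xs))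
     (real n * measure_pmf.prob p {x. Q x})
     (real n * (measure_pmf.prob p {x. Q x} * (1 - measure_pmf.prob p {x. Q x})))"
proof (induction n)
  case 0
  then show ?case by (simp add: moments_def)
next
  case (Suc n)
  have "(\<lambda>x. length (filter Q (case x of (x, xs) \<Rightarrow> x # xs))) =
      (\<lambda>(x, xs). of_bool (Q x) + length (filter Q xs))" by auto
  then show ?case
    using moments_pair[OF moments_indicator Suc.IH]
    by (simp add: replicate_pmf_Suc moments_map algebra_simps del: replicate_pmf.simps)
qed

text \<open>The second moment \<open>e\<close> solves the linear equation
  \<open>e = r * (e + 2 * r / (1 - r) + 1)\<close>, obtained by conditioning on the first
  trial.\<close>

lemma moments_geometric:
  assumes "0 \<le> r" "r < 1"
  shows "moments (geometric_pmf (1 - r)) id (r / (1 - r)) (r / (1 - r)\<^sup>2)"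
proof -
  let ?G = "geometric_pmf (1 - r)"
  have r: "1 - r \<in> {0<..1}" using assms by simp
  have e1: "(\<integral>\<^sup>+x. ennreal (real x) \<partial>?G) = ennreal (r / (1 - r))"
    using expectation_geometric_pmf[OF r] integrable_real_geometric_pmf[OF r]
    by (subst nn_integral_eq_integral) auto
  \<comment> \<open>Finiteness of the second moment must be known before the recursion below can be solved for it.\<close>
  have "summable (\<lambda>n. diffs (diffs (\<lambda>_. 1)) n * r ^ n)"
    by (rule termdiff_converges[where K = 1], use assms in simp)
       (rule termdiff_converges[where K = 1], simp_all add: summable_geometric)
  then have s: "summable (\<lambda>n. (1 - r) * (diffs (diffs (\<lambda>_. 1)) n * r ^ n))"
    by (rule summable_mult)
  have "(\<integral>\<^sup>+x. ennreal ((real x)\<^sup>2) \<partial>?G) =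
      (\<integral>\<^sup>+x. ennreal (r ^ x * (1 - r)) * ennreal ((real x)\<^sup>2) \<partial>count_space UNIV)"
    using assms r by (simp add: nn_integral_measure_pmf)
  also have "\<dots> \<le> (\<integral>\<^sup>+n. ennreal ((1 - r) * (diffs (diffs (\<lambda>_. 1)) n * r ^ n)) \<partial>count_space UNIV)"
  proof (intro nn_integral_mono)
    fix n
    \<comment> \<open>The coefficient on the right is \<open>(n + 1) * (n + 2)\<close>, from the
      second derivative of the geometric series.\<close>
    have "(real n)\<^sup>2 \<le> diffs (diffs (\<lambda>_. 1)) n"
      by (simp add: diffs_def power2_eq_square algebra_simps)
    then have "r ^ n * (1 - r) * (real n)\<^sup>2 \<le> r ^ n * (1 - r) * diffs (diffs (\<lambda>_. 1)) n"
      using assms by (intro mult_left_mono) auto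
    then have "ennreal (r ^ n * (1 - r) * (real n)\<^sup>2)
        \<le> ennreal ((1 - r) * (diffs (diffs (\<lambda>_. 1)) n * r ^ n))"
      by (intro ennreal_leI) (simp add: mult_ac)
    then show "ennreal (r ^ n * (1 - r)) * ennreal ((real n)\<^sup>2)
        \<le> ennreal ((1 - r) * (diffs (diffs (\<lambda>_. 1)) n * r ^ n))"
      using assms by (simp add: ennreal_mult)
  qed
  also have "\<dots> < \<infinity>"
  proof -
    have nn: "0 \<le> (1 - r) * (diffs (diffs (\<lambda>_. 1)) n * r ^ n)" for n
      using assms by (simp add: diffs_def)
    show ?thesis
      using s nn by (simp add: nn_integral_count_space_nat suminf_ennreal2)
  qed
  finally obtain e where e: "0 \<le> e" "(\<integral>\<^sup>+x. ennreal ((real x)\<^sup>2) \<partial>?G) = ennreal e"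
    by (cases "\<integral>\<^sup>+x. ennreal ((real x)\<^sup>2) \<partial>?G") auto
  have "ennreal e = (\<integral>\<^sup>+x. ennreal ((real x)\<^sup>2)
      \<partial>bind_pmf (bernoulli_pmf (1 - r)) (\<lambda>b. if b then return_pmf 0 else map_pmf Suc ?G))"
    using geometric_bind_pmf_unfold[OF r] e(2) by simp
  also have "\<dots> = ennreal r * (\<integral>\<^sup>+x. ennreal ((real (Suc x))\<^sup>2) \<partial>?G)"
    using assms by (simp add: mult.commute)
  also have "(\<integral>\<^sup>+x. ennreal ((real (Suc x))\<^sup>2) \<partial>?G) =
      (\<integral>\<^sup>+x. ennreal ((real x)\<^sup>2) + (ennreal 2 * ennreal (real x) + ennreal 1) \<partial>?G)"
  proof (intro nn_integral_cong)
    fix x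
    have *: "(real (Suc x))\<^sup>2 = (real x)\<^sup>2 + (2 * real x + 1)"
      by (simp add: power2_eq_square algebra_simps)
    show "ennreal ((real (Suc x))\<^sup>2) = ennreal ((real x)\<^sup>2) + (ennreal 2 * ennreal (real x) + ennreal 1)"
      unfolding * by (subst ennreal_plus, simp, simp, subst ennreal_plus, simp, simp, subst ennreal_mult) simp_all
  qed
  also have "\<dots> = ennreal e + (ennreal 2 * ennreal (r / (1 - r)) + ennreal 1)"
    using e e1 by (simp add: nn_integral_add nn_integral_cmult)
  also have "ennreal r * \<dots> = ennreal (r * (e + (2 * (r / (1 - r)) + 1)))"
    using assms e by (simp flip: ennreal_plus ennreal_mult ennreal_numeral ennreal_1)
  finally have "e = r * (e + (2 * (r / (1 - r)) + 1))"
    using assms e by (subst (asm) ennreal_inj) auto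
  then have "e * (1 - r) = r * (1 + r) / (1 - r)"
    using assms by (simp add: field_simps)
  then have "e * (1 - r)\<^sup>2 = r * (1 + r)"
    using assms by (simp add: power2_eq_square flip: mult.assoc)
  then have "e = (r\<^sup>2 + r) / (1 - r)\<^sup>2"
    using assms by (simp add: eq_divide_eq power2_eq_square distrib_left add.commute)
  then have "e = (r / (1 - r))\<^sup>2 + r / (1 - r)\<^sup>2"
    by (simp add: power_divide add_divide_distrib)
  then show ?thesis using e e1 assms by (simp add: moments_def)
qed

lemma moments_geometric_sum:
  assumes "finite I" "\<And>i. i \<in> I \<Longrightarrow> 0 \<le> r i \<and> r i < 1"
  shows "moments (Pi_pmf I 0 (\<lambda>i. geometric_pmf (1 - r i))) (\<lambda>c. \<Sum>i\<in>I. c i)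
     (\<Sum>i\<in>I. r i / (1 - r i)) (\<Sum>i\<in>I. r i / (1 - r i)\<^sup>2)"
  using assms
proof (induction I rule: finite_induct)
  case empty
  then show ?case by (simp add: moments_def)
next
  case (insert x I)
  have eq: "(\<lambda>c. \<Sum>i\<in>insert x I. (case c of (y, f) \<Rightarrow> f(x := y)) i) = (\<lambda>(y, f). id y + (\<Sum>i\<in>I. f i))"
  proof (rule ext, clarify)
    fix y f
    have "(\<Sum>i\<in>I. (f(x := y)) i) = (\<Sum>i\<in>I. f i)"
      by (rule sum.cong) (use insert.hyps in auto)
    then show "(\<Sum>i\<in>insert x I. (f(x := y)) i) = id y + (\<Sum>i\<in>I. f i)"
      using insert.hyps by simp
  qed
  then show ?case
    using moments_pair[OF moments_geometric insert.IH, of "r x"] insert.prems insert.hyps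
    unfolding Pi_pmf_insert[OF insert.hyps] moments_map eq by simp
qed

section \<open>Transducers preserving a product law\<close>

text \<open>Both laws have total mass one, so if they differ, some point has strictly larger mass
  under the image law. Such a point lies in the image of the support, where injectivity and
  invariance of the weights give equal masses.\<close>

lemma map_pmf_invariant:
  assumes "inj_on f (set_pmf N)" "\<And>x. x \<in> set_pmf N \<Longrightarrow> pmf N (f x) = pmf N x"
  shows "map_pmf f N = N"
proof (rule ccontr)
  assume "map_pmf f N \<noteq> N"
  then obtain y where y: "pmf N y < pmf (map_pmf f N) y"
    using pmf_neq_exists_less by metis
  then have "y \<in> f ` set_pmf N"
    using pmf_map_outside[of y f N] pmf_nonneg[of N y] by fastforce
  then show False using y pmf_map_inj[OF assms(1)] assms(2) by auto
qed

fun run :: "('s \<times> 'a \<Rightarrow> 's \<times> 'a) \<Rightarrow> 's \<Rightarrow> 'a list \<Rightarrow> 's \<times> 'a list" where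
  "run f c [] = (c, [])"
| "run f c (y # ys) = (let (c', z) = f (c, y); (c'', zs) = run f c' ys in (c'', z # zs))"

text \<open>After one step the new state and the output letter are again independent with the old
  laws. The rest of the run is then driven by a fresh stationary state, independent of the letter
  already emitted.\<close>

lemma run_invariant:
  assumes "map_pmf f (pair_pmf M p) = pair_pmf M p"
  shows "map_pmf (\<lambda>(c, ys). run f c ys) (pair_pmf M (replicate_pmf n p)) = pair_pmf M (replicate_pmf n p)"
proof (induction n)
  case 0
  then show ?case by (simp add: pair_return_pmf2 pmf.map_comp o_def)
next
  case (Suc n)
  let ?R = "replicate_pmf n p"
  have "map_pmf (\<lambda>(c, ys). run f c ys) (pair_pmf M (replicate_pmf (Suc n) p)) =
      pair_pmf M p \<bind> (\<lambda>s. case f s of (c', z) \<Rightarrow> ?R \<bind> (\<lambda>ys. case run f c' ys of (c'', zs) \<Rightarrow> return_pmf (c'', z # zs)))"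
    by (simp add: pair_pmf_def map_pmf_def bind_assoc_pmf bind_return_pmf case_prod_unfold Let_def)
  also have "\<dots> = map_pmf f (pair_pmf M p) \<bind> (\<lambda>(c', z). ?R \<bind> (\<lambda>ys. case run f c' ys of (c'', zs) \<Rightarrow> return_pmf (c'', z # zs)))"
    by (simp add: map_pmf_def bind_assoc_pmf bind_return_pmf)
  also have "\<dots> = pair_pmf M p \<bind> (\<lambda>(c', z). ?R \<bind> (\<lambda>ys. case run f c' ys of (c'', zs) \<Rightarrow> return_pmf (c'', z # zs)))"
    by (simp only: assms)
  also have "\<dots> = p \<bind> (\<lambda>z. map_pmf (\<lambda>(c, ys). run f c ys) (pair_pmf M ?R) \<bind> (\<lambda>(c'', zs). return_pmf (c'', z # zs)))"
    by (simp add: pair_pmf_def map_pmf_def bind_assoc_pmf bind_return_pmf case_prod_unfold)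
       (subst bind_commute_pmf, simp)
  also have "\<dots> = p \<bind> (\<lambda>z. pair_pmf M ?R \<bind> (\<lambda>(c'', zs). return_pmf (c'', z # zs)))"
    by (simp only: Suc.IH)
  also have "\<dots> = pair_pmf M (replicate_pmf (Suc n) p)"
    by (simp add: pair_pmf_def bind_assoc_pmf bind_return_pmf case_prod_unfold)
       (subst bind_commute_pmf, simp)
  finally show ?case .
qed

lemma moments_outputs:
  assumes "map_pmf f (pair_pmf M p) = pair_pmf M p"
  shows "moments (pair_pmf M (replicate_pmf n p)) (\<lambda>(c, ys). count_list (snd (run f c ys)) z)
     (real n * pmf p z) (real n * (pmf p z * (1 - pmf p z)))"
proof -
  have "moments (replicate_pmf n p) (\<lambda>ys. count_list ys z)
     (real n * pmf p z) (real n * (pmf p z * (1 - pmf p z)))"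
    using moments_count[of n p "(=) z"] by (simp add: count_list_eq_length_filter measure_pmf_single)
  then have "moments (map_pmf snd (pair_pmf M (replicate_pmf n p))) (\<lambda>ys. count_list ys z)
     (real n * pmf p z) (real n * (pmf p z * (1 - pmf p z)))"
    by (simp add: map_snd_pair_pmf)
  then have "moments (map_pmf (\<lambda>(c, ys). run f c ys) (pair_pmf M (replicate_pmf n p)))
      (\<lambda>x. count_list (snd x) z) (real n * pmf p z) (real n * (pmf p z * (1 - pmf p z)))"
    by (simp add: run_invariant[OF assms] moments_map)
  then show ?thesis by (simp add: moments_map case_prod_unfold)
qed

text \<open>One more customer in queue \<open>i\<close> costs a factor \<open>r i\<close>; this is
  the local balance relation behind both weight computations. A state that is nonzero outside
  \<open>I\<close> has weight zero before and after.\<close>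

lemma pmf_geometric_shift:
  assumes "finite I" "i \<in> I" "\<And>i. i \<in> I \<Longrightarrow> 0 \<le> r i \<and> r i < 1"
  shows "pmf (Pi_pmf I 0 (\<lambda>i. geometric_pmf (1 - r i))) (c(i := Suc (c i))) =
    r i * pmf (Pi_pmf I 0 (\<lambda>i. geometric_pmf (1 - r i))) c"
  (is "pmf ?M (c(i := Suc (c i))) = _")
proof (cases "\<forall>j. j \<notin> I \<longrightarrow> c j = 0")
  case True
  have "pmf ?M (c(i := Suc (c i))) =
      (\<Prod>j\<in>I. pmf (geometric_pmf (1 - r j)) ((c(i := Suc (c i))) j))"
    using assms True by (intro pmf_Pi') auto
  also have "\<dots> = pmf (geometric_pmf (1 - r i)) (Suc (c i)) *
      (\<Prod>j\<in>I - {i}. pmf (geometric_pmf (1 - r j)) ((c(i := Suc (c i))) j))"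
    using assms by (subst prod.remove[of I i]) auto
  also have "(\<Prod>j\<in>I - {i}. pmf (geometric_pmf (1 - r j)) ((c(i := Suc (c i))) j)) =
      (\<Prod>j\<in>I - {i}. pmf (geometric_pmf (1 - r j)) (c j))"
    by (rule prod.cong) auto
  also have "pmf (geometric_pmf (1 - r i)) (Suc (c i)) = r i * pmf (geometric_pmf (1 - r i)) (c i)"
    using assms by simp
  finally have "pmf ?M (c(i := Suc (c i))) = r i * (pmf (geometric_pmf (1 - r i)) (c i) *
      (\<Prod>j\<in>I - {i}. pmf (geometric_pmf (1 - r j)) (c j)))"
    by (simp only: mult.assoc)
  also have "pmf (geometric_pmf (1 - r i)) (c i) *
      (\<Prod>j\<in>I - {i}. pmf (geometric_pmf (1 - r j)) (c j)) =
      (\<Prod>j\<in>I. pmf (geometric_pmf (1 - r j)) (c j))"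
    by (rule prod.remove[OF assms(1,2), symmetric])
  also have "\<dots> = pmf ?M c"
    using assms(1) True by (intro pmf_Pi'[symmetric]) auto
  finally show ?thesis .
next
  case False
  then obtain j where "j \<notin> I" "c j \<noteq> 0" by auto
  moreover from this have "(c(i := Suc (c i))) j \<noteq> 0" by simp
  ultimately show ?thesis
    using pmf_Pi_outside[OF assms(1), of c 0] pmf_Pi_outside[OF assms(1), of "c(i := Suc (c i))" 0]
    by (metis mult_zero_right)
qed

section \<open>Row insertion and queues in series\<close>

text \<open>RSK insertion of the letter \<open>j\<close> into a first row with \<open>c i\<close> copies of \<open>i\<close> for each \<open>i > k\<close>. Letters
  below \<open>k\<close> are ignored and the copies of \<open>k\<close> are not recorded. The output is the bumped letter, or
  \<open>k\<close> when the row grows.\<close>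

definition row_insert :: "nat \<Rightarrow> (nat \<Rightarrow> nat) \<times> nat \<Rightarrow> (nat \<Rightarrow> nat) \<times> nat" where
  "row_insert k = (\<lambda>(c, j).
     if j < k then (c, j)
     else let c' = (if j = k then c else c(j := Suc (c j))) in
       if \<exists>i>j. 0 < c i then let i = (LEAST i. j < i \<and> 0 < c i) in (c'(i := c i - 1), i)
       else (c', k))"

lemma row_insert_cases:
  fixes c :: "nat \<Rightarrow> nat" and j k :: nat
  obtains (null) "j < k" "row_insert k (c, j) = (c, j)"
  | (bump) i where "k \<le> j" "j < i" "0 < c i" "\<forall>l. j < l \<and> l < i \<longrightarrow> c l = 0"
      "row_insert k (c, j) = ((if j = k then c else c(j := Suc (c j)))(i := c i - 1), i)"
  | (grow) "k \<le> j" "\<forall>l>j. c l = 0"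
      "row_insert k (c, j) = (if j = k then c else c(j := Suc (c j)), k)"
proof -
  consider "j < k" | "k \<le> j" "\<exists>i>j. 0 < c i" | "k \<le> j" "\<forall>l>j. c l = 0" by force
  then show thesis
  proof cases
    case 1
    then show thesis by (intro null) (simp_all add: row_insert_def)
  next
    case 2
    define i where "i = (LEAST i. j < i \<and> 0 < c i)"
    have "j < i \<and> 0 < c i" unfolding i_def using 2(2) by (rule LeastI_ex)
    moreover have "\<forall>l. j < l \<and> l < i \<longrightarrow> c l = 0"
    proof (intro allI impI)
      fix l assume l: "j < l \<and> l < i"
      then have "l < (LEAST i. j < i \<and> 0 < c i)" by (simp add: i_def)
      then have "\<not> (j < l \<and> 0 < c l)" by (rule not_less_Least)
      then show "c l = 0" using l by simp
    qed
    moreover have "row_insert k (c, j) = ((if j = k then c else c(j := Suc (c j)))(i := c i - 1), i)"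
      using 2 by (simp add: row_insert_def i_def Let_def)
    ultimately show thesis using bump 2(1) by blast
  next
    case 3
    then have nex: "(\<exists>i>j. 0 < c i) = False" by simp
    have "row_insert k (c, j) = (if j = k then c else c(j := Suc (c j)), k)"
      unfolding row_insert_def Let_def prod.case nex using 3(1) by simp
    then show thesis using grow 3 by blast
  qed
qed

text \<open>The result determines the inserted letter, and then the output tells which copy was
  removed.\<close>

lemma row_insert_inj:
  assumes "c1 k = 0" "c2 k = 0" "row_insert k (c1, j1) = row_insert k (c2, j2)"
  shows "(c1, j1) = (c2, j2)"
proof -
  \<comment> \<open>Inserting \<open>b\<close> at or above \<open>k\<close> after
    \<open>a < b\<close> is excluded as follows: when \<open>a\<close> acts on the row, no copy lies
    between \<open>a\<close> and the bumped letter, or above \<open>a\<close> if the row grows,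
    whereas inserting \<open>b\<close> leaves a copy of \<open>b\<close> there. An ignored letter
    below \<open>k\<close> is its own output.\<close>
  have not_less: "\<not> a < b" if eq: "row_insert k (c, a) = row_insert k (c', b)" for a b c c'
  proof
    assume "a < b"
    show False
    proof (cases rule: row_insert_cases[of a k c])
      case null
      then show False
        by (cases rule: row_insert_cases[of b k c']) (use eq \<open>a < b\<close> in auto)
    next
      case (bump i)
      then show False
        by (cases rule: row_insert_cases[of b k c'])
           (use eq \<open>a < b\<close> in \<open>auto simp: fun_eq_iff split: if_splits; metis Suc_neq_Zero less_irrefl less_trans nat_neq_iff\<close>)+
    next
      case grow
      then show False
        by (cases rule: row_insert_cases[of b k c'])
           (use eq \<open>a < b\<close> in \<open>auto simp: fun_eq_iff split: if_splits; metis Suc_neq_Zero less_irrefl less_trans nat_neq_iff\<close>)+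
    qed
  qed
  have j: "j1 = j2"
    using not_less[of c1 j1 c2 j2] not_less[of c2 j2 c1 j1] assms(3) by (metis linorder_neqE_nat)
  have "c1 = c2"
  proof
    fix x
    have "fst (row_insert k (c1, j1)) x = fst (row_insert k (c2, j1)) x"
      "snd (row_insert k (c1, j1)) = snd (row_insert k (c2, j1))"
      using assms(3) j by auto
    then show "c1 x = c2 x"
      by (cases rule: row_insert_cases[of j1 k c1]; cases rule: row_insert_cases[of j1 k c2])
         (auto split: if_splits)
  qed
  then show ?thesis using j by simp
qed

text \<open>Burke's theorem in disguise: insertion is injective on pairs (state, letter) and preserves the
  product of the geometric weights of the state with the weight of the letter. Hence the output
  letters are again independent with the same law.\<close>

lemma row_insert_weight:
  fixes k d :: nat and r p :: "nat \<Rightarrow> real"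
  defines "M \<equiv> Pi_pmf {k<..d} 0 (\<lambda>i. geometric_pmf (1 - r i))"
  assumes r: "\<And>i. i \<in> {k<..d} \<Longrightarrow> 0 \<le> r i \<and> r i < 1 \<and> p i = p k * r i"
    and c: "\<forall>i. i \<notin> {k<..d} \<longrightarrow> c i = 0" and j: "j \<le> d"
  shows "pmf M (fst (row_insert k (c, j))) * p (snd (row_insert k (c, j))) = pmf M c * p j"
proof -
  have shift: "pmf M (b(i := Suc (b i))) = r i * pmf M b" if "i \<in> {k<..d}" for b i
    unfolding M_def using that r by (intro pmf_geometric_shift) auto
  \<comment> \<open>Recording \<open>j > k\<close> multiplies the state weight by
    \<open>r j\<close>, and \<open>p j = p k * r j\<close>: the letter weight \<open>p j\<close> is
    exchanged for \<open>p k\<close>.\<close>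
  have put: "pmf M (if j = k then b else b(j := Suc (b j))) * p k = pmf M b * p j" if "k \<le> j" for b
    using that shift[of j b] r[of j] j by (cases "j = k") auto
  show ?thesis
  proof (cases rule: row_insert_cases[of j k c])
    case (bump i)
    then have i: "i \<in> {k<..d}" using c by force
    \<comment> \<open>With the bumped copy removed first, the old and the new state both arise from
      \<open>b\<close> by adding at most one letter.\<close>
    define b where "b = c(i := c i - 1)"
    have cb: "c = b(i := Suc (b i))" using bump by (auto simp: b_def)
    have "(if j = k then c else c(j := Suc (c j)))(i := c i - 1) = (if j = k then b else b(j := Suc (b j)))"
      using bump by (auto simp: b_def fun_eq_iff)
    moreover have "pmf M c = r i * pmf M b" using shift[OF i] cb by metis
    ultimately show ?thesis
      using put[OF bump(1), of b] r[OF i] bump(5) by simp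
  qed (use put in auto)
qed

lemma row_insert_support:
  assumes "\<forall>i. i \<notin> {k<..d} \<longrightarrow> c i = 0" "j \<le> d" "i \<notin> {k<..d}"
  shows "fst (row_insert k (c, j)) i = 0"
  using assms by (cases rule: row_insert_cases[of j k c]) auto

lemma row_insert_invariant:
  fixes k d :: nat and r :: "nat \<Rightarrow> real"
  defines "M \<equiv> Pi_pmf {k<..d} 0 (\<lambda>i. geometric_pmf (1 - r i))"
  assumes r: "\<And>i. i \<in> {k<..d} \<Longrightarrow> 0 \<le> r i \<and> r i < 1 \<and> pmf Y i = pmf Y k * r i"
    and Y: "set_pmf Y \<subseteq> {..d}"
  shows "map_pmf (row_insert k) (pair_pmf M Y) = pair_pmf M Y"
proof (rule map_pmf_invariant)
  have supp: "\<forall>i. i \<notin> {k<..d} \<longrightarrow> c i = 0" if "c \<in> set_pmf M" for c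
    using that set_Pi_pmf_subset[of "{k<..d}" 0] unfolding M_def by fastforce
  show "inj_on (row_insert k) (set_pmf (pair_pmf M Y))"
  proof (rule inj_onI)
    fix x y
    assume "x \<in> set_pmf (pair_pmf M Y)" "y \<in> set_pmf (pair_pmf M Y)" "row_insert k x = row_insert k y"
    moreover from this have "fst x k = 0" "fst y k = 0" using supp by auto
    ultimately show "x = y" using row_insert_inj[of "fst x" k "fst y" "snd x" "snd y"] by simp
  qed
  show "pmf (pair_pmf M Y) (row_insert k x) = pmf (pair_pmf M Y) x"
    if mem: "x \<in> set_pmf (pair_pmf M Y)" for x
  proof -
    obtain c j where x: "x = (c, j)" "c \<in> set_pmf M" "j \<le> d"
      using mem Y by (cases x) auto
    then show ?thesis
      using row_insert_weight[of k d r "pmf Y" c j] r supp[of c]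
      by (cases "row_insert k (c, j)") (auto simp: pmf_pair M_def)
  qed
qed

text \<open>The potential is the row content strictly above the current path value \<open>u\<close>.
  A letter \<open>u\<close> or larger either makes the row grow, giving output \<open>k\<close>, or
  bumps a larger letter out of the counted part, which pays for a hit or for the newly counted copy.
  When the path rises, content is only discarded.\<close>

lemma row_insert_hits:
  assumes "mono h" "\<forall>t. v \<le> h t" "k \<le> v"
    and "\<forall>i. i \<notin> {k<..d} \<longrightarrow> c i = 0" "set ys \<subseteq> {..d}"
  shows "hits ys h \<le> count_list (snd (run (row_insert k) c ys)) k + (\<Sum>i\<in>{v<..d}. c i)"
  using assms
proof (induction ys arbitrary: c h v)
  case (Cons j ys)
  define c' where "c' = fst (row_insert k (c, j))"
  define z where "z = snd (row_insert k (c, j))"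
  define u where "u = h 0"
  have cz: "row_insert k (c, j) = (c', z)" by (simp add: c'_def z_def)
  have u: "v \<le> u" "k \<le> u"
    using Cons.prems(2) order_trans[OF Cons.prems(3), of u] by (auto simp: u_def)
  have "hits ys (\<lambda>t. h (Suc t)) \<le> count_list (snd (run (row_insert k) c' ys)) k + (\<Sum>i\<in>{u<..d}. c' i)"
  proof (rule Cons.IH)
    show "\<forall>i. i \<notin> {k<..d} \<longrightarrow> c' i = 0"
      unfolding c'_def using row_insert_support[OF Cons.prems(4)] Cons.prems(5) by simp
  qed (use Cons.prems u in \<open>auto simp: u_def mono_def\<close>)
  moreover have "of_bool (j = u) + (\<Sum>i\<in>{u<..d}. c' i) \<le> of_bool (z = k) + (\<Sum>i\<in>{u<..d}. c i)"
  proof -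
    have put: "(\<Sum>i\<in>{u<..d}. (if j = k then b else b(j := Suc (b j))) i) =
        of_bool (u < j) + (\<Sum>i\<in>{u<..d}. b i)" for b :: "nat \<Rightarrow> nat"
    proof -
      have "(\<Sum>i\<in>{u<..d}. (if j = k then b else b(j := Suc (b j))) i) =
          (\<Sum>i\<in>{u<..d}. b i + (if i = j then 1 else 0))"
        using u by (intro sum.cong) auto
      then show ?thesis using Cons.prems(5) by (simp add: sum.distrib)
    qed
    show ?thesis
    proof (cases rule: row_insert_cases[of j k c])
      case null
      then show ?thesis using cz u by auto
    next
      case (bump i)
      then have i: "i \<le> d" using Cons.prems(4) by force
      define b where "b = c(i := c i - 1)"
      have "c' = (if j = k then b else b(j := Suc (b j)))"
        using bump cz by (auto simp: b_def fun_eq_iff)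
      moreover have "(\<Sum>i\<in>{u<..d}. c i) = of_bool (u < i) + (\<Sum>i\<in>{u<..d}. b i)"
      proof -
        have "(\<Sum>i\<in>{u<..d}. c i) = (\<Sum>l\<in>{u<..d}. b l + (if l = i then 1 else 0))"
          using bump by (intro sum.cong) (auto simp: b_def)
        then show ?thesis using i by (simp add: sum.distrib)
      qed
      ultimately show ?thesis using bump put[of b] by auto
    next
      case grow
      then show ?thesis using cz put[of c] by auto
    qed
  qed
  moreover have "(\<Sum>i\<in>{u<..d}. c i) \<le> (\<Sum>i\<in>{v<..d}. c i)"
    using u by (intro sum_mono2) auto
  ultimately show ?case
    using cz by (cases "j = u"; cases "z = k") (simp_all add: case_prod_unfold Let_def u_def)
qed simp

text \<open>\<open>k - 1\<close> queues in series with \<open>c i\<close> customers in queue \<open>i\<close>: the letter \<open>k\<close> is an arrival at queue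
  \<open>k - 1\<close>, a letter \<open>j < k\<close> serves queue \<open>j\<close> and sends a customer on to queue \<open>j - 1\<close>, and
  \<open>0\<close> is ignored. The output \<open>k\<close> marks a customer leaving the last queue; the other outputs are the
  letters that make the system run backwards.\<close>

definition tandem :: "nat \<Rightarrow> (nat \<Rightarrow> nat) \<times> nat \<Rightarrow> (nat \<Rightarrow> nat) \<times> nat" where
  "tandem k = (\<lambda>(c, j).
     if 1 \<le> j \<and> j \<le> k \<and> (j = k \<or> 0 < c j) then
       let c' = (if j = k then c else c(j := c j - 1)) in
       if j = 1 then (c', k) else (c'(j - 1 := Suc (c (j - 1))), j - 1)
     else (c, j))"

lemma tandem_cases:
  fixes c :: "nat \<Rightarrow> nat" and j k :: nat
  assumes "j \<le> k" "1 \<le> k"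
  obtains (idle) "j < k" "j = 0 \<or> c j = 0" "tandem k (c, j) = (c, j)"
  | (out) "j = 1" "j = k \<or> 0 < c j" "tandem k (c, j) = (if j = k then c else c(j := c j - 1), k)"
  | (move) i where "1 \<le> i" "j = Suc i" "j = k \<or> 0 < c j"
     "tandem k (c, j) = ((if j = k then c else c(j := c j - 1))(i := Suc (c i)), i)"
proof -
  consider "j < k" "j = 0 \<or> c j = 0" | "j = 1" "j = k \<or> 0 < c j" | "1 < j" "j = k \<or> 0 < c j"
    using assms by linarith
  then show thesis
  proof cases
    case 1
    then show thesis by (intro idle) (auto simp: tandem_def)
  next
    case 2
    then show thesis using assms by (intro out) (auto simp: tandem_def Let_def)
  next
    case 3
    then show thesis using assms by (intro move[of "j - 1"]) (auto simp: tandem_def Let_def)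
  qed
qed

text \<open>Output \<open>k\<close> means that a customer left. Any other output \<open>i\<close>
  comes from an idle step if \<open>i = 0\<close> or queue \<open>i\<close> is empty afterwards, and
  from a move into queue \<open>i\<close> otherwise; this fixes the input letter.\<close>

lemma tandem_inj:
  assumes "j1 \<le> k" "j2 \<le> k" "1 \<le> k" "tandem k (c1, j1) = tandem k (c2, j2)"
  shows "(c1, j1) = (c2, j2)"
proof -
  have eq: "fst (tandem k (c1, j1)) x = fst (tandem k (c2, j2)) x"
    "snd (tandem k (c1, j1)) = snd (tandem k (c2, j2))" for x
    using assms(4) by auto
  have j: "j1 = j2"
    using eq(1)[of "snd (tandem k (c1, j1))"] eq(2) assms(1,2)
    by (cases rule: tandem_cases[OF assms(1,3), of c1]; cases rule: tandem_cases[OF assms(2,3), of c2]) auto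
  have "c1 = c2"
  proof
    fix x
    show "c1 x = c2 x"
      using eq(1)[of x] eq(2) unfolding j
      by (cases rule: tandem_cases[OF assms(2,3), of c1]; cases rule: tandem_cases[OF assms(2,3), of c2])
         (auto split: if_splits)
  qed
  then show ?thesis using j by simp
qed

lemma tandem_weight:
  fixes k :: nat and r p :: "nat \<Rightarrow> real"
  defines "M \<equiv> Pi_pmf {1..<k} 0 (\<lambda>i. geometric_pmf (1 - r i))"
  assumes r: "\<And>i. i \<in> {1..<k} \<Longrightarrow> 0 \<le> r i \<and> r i < 1 \<and> p k = p i * r i"
    and j: "j \<le> k" "1 \<le> k"
  shows "pmf M (fst (tandem k (c, j))) * p (snd (tandem k (c, j))) = pmf M c * p j"
proof -
  have shift: "pmf M (b(i := Suc (b i))) = r i * pmf M b" if "i \<in> {1..<k}" for b i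
    unfolding M_def using that r by (intro pmf_geometric_shift) auto
  define b where "b = (if j = k then c else c(j := c j - 1))"
  \<comment> \<open>Taking a customer out of queue \<open>j\<close> trades the weight
    \<open>p j\<close> for \<open>p k\<close>, because \<open>p k = p j * r j\<close>; an arrival
    carries \<open>p k\<close> already. Joining the next queue is the same trade in reverse.\<close>
  have served: "pmf M c * p j = pmf M b * p k" if "1 \<le> j" "j = k \<or> 0 < c j"
  proof (cases "j = k")
    case False
    then have "c = b(j := Suc (b j))" using that by (auto simp: b_def)
    then have "pmf M c = r j * pmf M b" using shift[of j b] False that j by auto
    then show ?thesis using r[of j] False that j by simp
  qed (simp add: b_def)
  show ?thesis
    using j
  proof (cases rule: tandem_cases[of j k c])
    case (move i)
    have "(if j = k then c else c(j := c j - 1))(i := Suc (c i)) = b(i := Suc (b i))"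
      using move by (auto simp: b_def)
    moreover have "i \<in> {1..<k}" using move j by auto
    ultimately show ?thesis using move served shift[of i b] r[of i] by simp
  qed (use served in \<open>auto simp: b_def\<close>)
qed

lemma tandem_invariant:
  fixes k :: nat and r :: "nat \<Rightarrow> real"
  defines "M \<equiv> Pi_pmf {1..<k} 0 (\<lambda>i. geometric_pmf (1 - r i))"
  assumes r: "\<And>i. i \<in> {1..<k} \<Longrightarrow> 0 \<le> r i \<and> r i < 1 \<and> pmf Y k = pmf Y i * r i"
    and Y: "set_pmf Y \<subseteq> {..k}" and k: "1 \<le> k"
  shows "map_pmf (tandem k) (pair_pmf M Y) = pair_pmf M Y"
proof (rule map_pmf_invariant)
  show "inj_on (tandem k) (set_pmf (pair_pmf M Y))"
  proof (rule inj_onI)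
    fix x y
    assume "x \<in> set_pmf (pair_pmf M Y)" "y \<in> set_pmf (pair_pmf M Y)" "tandem k x = tandem k y"
    moreover from this have "snd x \<le> k" "snd y \<le> k" using Y by auto
    ultimately show "x = y" using tandem_inj[of "snd x" k "snd y" "fst x" "fst y"] k by simp
  qed
  show "pmf (pair_pmf M Y) (tandem k x) = pmf (pair_pmf M Y) x"
    if mem: "x \<in> set_pmf (pair_pmf M Y)" for x
  proof -
    obtain c j where x: "x = (c, j)" "j \<le> k"
      using mem Y by (cases x) auto
    then show ?thesis
      using tandem_weight[of k r "pmf Y" j c] r k
      by (cases "tandem k (c, j)") (auto simp: pmf_pair M_def)
  qed
qed

text \<open>The potential is the number of customers in queues below the current path value
  \<open>u\<close>. A customer can enter this region, or leave the system directly if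
  \<open>u = 1\<close>, only through the letter \<open>u\<close>, which is a hit; any other
  departure lowers the potential by one. When the path falls, the region shrinks.\<close>

lemma tandem_hits:
  assumes "antimono g" "\<forall>t. 1 \<le> g t \<and> g t \<le> v" "v \<le> k" "set ys \<subseteq> {..k}"
  shows "count_list (snd (run (tandem k) c ys)) k \<le> hits ys g + (\<Sum>i\<in>{1..<v}. c i)"
  using assms
proof (induction ys arbitrary: c g v)
  case (Cons j ys)
  define c' where "c' = fst (tandem k (c, j))"
  define z where "z = snd (tandem k (c, j))"
  define u where "u = g 0"
  have cz: "tandem k (c, j) = (c', z)" by (simp add: c'_def z_def)
  have u: "1 \<le> u" "u \<le> v" "u \<le> k" using Cons.prems(2,3) by (auto simp: u_def intro: order_trans)
  have j: "j \<le> k" "1 \<le> k" using Cons.prems(4) u by auto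
  have "count_list (snd (run (tandem k) c' ys)) k \<le> hits ys (\<lambda>t. g (Suc t)) + (\<Sum>i\<in>{1..<u}. c' i)"
    by (rule Cons.IH) (use Cons.prems u in \<open>auto simp: u_def antimono_def\<close>)
  moreover have "of_bool (z = k) + (\<Sum>i\<in>{1..<u}. c' i) \<le> of_bool (j = u) + (\<Sum>i\<in>{1..<u}. c i)"
  proof -
    define b where "b = (if j = k then c else c(j := c j - 1))"
    have served: "(\<Sum>i\<in>{1..<u}. c i) = of_bool (j < u) + (\<Sum>i\<in>{1..<u}. b i)"
      if "1 \<le> j" "j = k \<or> 0 < c j"
    proof -
      have "(\<Sum>i\<in>{1..<u}. c i) = (\<Sum>i\<in>{1..<u}. b i + (if i = j then 1 else 0))"
        using that u by (intro sum.cong) (auto simp: b_def)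
      then show ?thesis using that by (simp add: sum.distrib)
    qed
    show ?thesis
      using j
    proof (cases rule: tandem_cases[of j k c])
      case idle
      then show ?thesis using cz by simp
    next
      case out
      then show ?thesis using cz served u by (auto simp: b_def)
    next
      case (move i)
      have "(\<Sum>l\<in>{1..<u}. c' l) = (\<Sum>l\<in>{1..<u}. b l + (if l = i then 1 else 0))"
        using move cz by (intro sum.cong) (auto simp: b_def)
      then have "(\<Sum>l\<in>{1..<u}. c' l) = of_bool (i < u) + (\<Sum>l\<in>{1..<u}. b l)"
        using move by (simp add: sum.distrib)
      then show ?thesis using served move cz j by auto
    qed
  qed
  moreover have "(\<Sum>i\<in>{1..<u}. c i) \<le> (\<Sum>i\<in>{1..<v}. c i)"
    using u by (intro sum_mono2) auto
  ultimately show ?case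
    using cz by (cases "j = u"; cases "z = k") (simp_all add: case_prod_unfold Let_def u_def)
qed simp

section \<open>Second moment of a row length\<close>

text \<open>The random word is realised as a marginal of a larger space that also carries an initial
  queue state and one coin per letter.\<close>

lemma replicate_pmf_first:
  "replicate_pmf n p = map_pmf (\<lambda>(c, zs). map fst zs) (pair_pmf M (replicate_pmf n (pair_pmf p q)))"
proof -
  have "map_pmf (\<lambda>(c, zs). map fst zs) (pair_pmf M (replicate_pmf n (pair_pmf p q))) =
      map_pmf (map fst) (map_pmf snd (pair_pmf M (replicate_pmf n (pair_pmf p q))))"
    by (simp add: pmf.map_comp o_def case_prod_unfold)
  also have "\<dots> = replicate_pmf n p"
    by (simp add: map_snd_pair_pmf map_fst_pair_pmf flip: replicate_map_pmf)
  finally show ?thesis ..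
qed

lemma words_eq: "words d n = {w. set w \<subseteq> {1..d} \<and> length w = n}"
  by (auto simp: words_def)

lemma pmf_replicate:
  "length w = n \<Longrightarrow> pmf (replicate_pmf n p) w = (\<Prod>i<n. pmf p (w ! i))"
proof (induction n arbitrary: w)
  case (Suc n)
  then obtain x xs where w: "w = x # xs" "length xs = n" by (cases w) auto
  have "inj (\<lambda>(x, xs). x # xs)" by (auto simp: inj_on_def)
  from pmf_map_inj'[OF this, of "pair_pmf p (replicate_pmf n p)" "(x, xs)"]
  have "pmf (replicate_pmf (Suc n) p) w = pmf p x * pmf (replicate_pmf n p) xs"
    unfolding replicate_pmf_Suc w by (simp add: pmf_pair)
  then show ?case
    using Suc.IH[OF w(2)] by (simp only: prod.lessThan_Suc_shift) (simp add: w)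
qed simp

text \<open>Values of \<open>\<alpha>\<close> outside \<open>{1..d}\<close> are arbitrary and must
  be cut off to obtain a law.\<close>

lemma letter_law:
  assumes "prob_dist_sorted d \<alpha>"
  obtains A where "\<And>x. pmf A x = (if x \<in> {1..d} then \<alpha> x else 0)" "set_pmf A \<subseteq> {1..d}"
proof -
  let ?f = "\<lambda>x. if x \<in> {1..d} then \<alpha> x else 0"
  have nn: "0 \<le> ?f x" for x using assms by (simp add: prob_dist_sorted_def)
  have "(\<integral>\<^sup>+x. ennreal (?f x) \<partial>count_space UNIV) = (\<Sum>x\<in>{1..d}. ennreal (?f x))"
    by (rule nn_integral_count_space') auto
  also have "\<dots> = ennreal (\<Sum>x\<in>{1..d}. ?f x)"
    by (rule sum_ennreal) (rule nn)
  also have "(\<Sum>x\<in>{1..d}. ?f x) = 1"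
    using assms by (simp add: prob_dist_sorted_def)
  finally have one: "(\<integral>\<^sup>+x. ennreal (?f x) \<partial>count_space UNIV) = 1" by simp
  define A where "A = embed_pmf ?f"
  have "pmf A x = ?f x" for x unfolding A_def by (rule pmf_embed_pmf[OF nn one])
  moreover from this have "set_pmf A \<subseteq> {1..d}" by (auto simp: set_pmf_iff split: if_splits)
  ultimately show thesis using that by blast
qed

lemma word_expect_nn_integral:
  assumes A: "\<And>x. pmf A x = (if x \<in> {1..d} then \<alpha> x else 0)" "set_pmf A \<subseteq> {1..d}"
    and F: "\<And>w. 0 \<le> F w"
  shows "ennreal (word_expect d \<alpha> n F) = (\<integral>\<^sup>+w. ennreal (F w) \<partial>replicate_pmf n A)"
proof -
  have p: "pmf (replicate_pmf n A) w = (\<Prod>i<n. \<alpha> (w ! i))" if "w \<in> words d n" for w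
    using that by (subst pmf_replicate) (force simp: words_def A intro!: prod.cong)+
  have "(\<integral>\<^sup>+w. ennreal (F w) \<partial>replicate_pmf n A) =
      (\<Sum>w\<in>words d n. ennreal (F w) * ennreal (pmf (replicate_pmf n A) w))"
  proof (rule nn_integral_measure_pmf_support)
    show "finite (words d n)" unfolding words_eq by (intro finite_lists_length_eq) simp
    show "ennreal (F w) = 0" if "w \<in> set_pmf (replicate_pmf n A)" "w \<notin> words d n" for w
      using that A(2) by (auto simp: set_replicate_pmf words_def lists_eq_set)
  qed auto
  also have "\<dots> = (\<Sum>w\<in>words d n. ennreal ((\<Prod>i<n. \<alpha> (w ! i)) * F w))"
    using F by (intro sum.cong refl) (simp add: p[symmetric] mult.commute flip: ennreal_mult)
  also have "\<dots> = ennreal (word_expect d \<alpha> n F)"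
    unfolding word_expect_def using F by (intro sum_ennreal) (simp add: p[symmetric])
  finally show ?thesis ..
qed

text \<open>For a queue with load \<open>\<rho>\<close>, the rate gap \<open>e\<close> gives
  \<open>1 - \<rho> \<ge> e / P\<close>, which bounds mean and variance of its length. The load is
  only bounded by \<open>a / P\<close> because the queues in series are compared with the slowest
  possible server.\<close>

lemma ratio_bounds:
  fixes \<rho> a P e :: real
  assumes "0 \<le> \<rho>" "\<rho> \<le> a / P" "0 \<le> a" "0 < e" "a + e \<le> P"
  shows "\<rho> < 1" "\<rho> / (1 - \<rho>) \<le> a / e" "\<rho> / (1 - \<rho>)\<^sup>2 \<le> a * P / e\<^sup>2"
proof -
  have P: "0 < P" using assms by linarith
  have "e / P \<le> (P - a) / P" using P assms by (intro divide_right_mono) auto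
  also have "\<dots> = 1 - a / P" using P by (simp add: diff_divide_distrib)
  finally have e: "e / P \<le> 1 - \<rho>" using assms(2) by linarith
  have "0 < e / P" using P assms by simp
  then show "\<rho> < 1" using e by linarith
  have "\<rho> / (1 - \<rho>) \<le> (a / P) / (e / P)"
    using assms e \<open>0 < e / P\<close> P by (intro frac_le) auto
  then show "\<rho> / (1 - \<rho>) \<le> a / e" using P by simp
  have "\<rho> / (1 - \<rho>)\<^sup>2 \<le> (a / P) / (e / P)\<^sup>2"
    using assms e \<open>0 < e / P\<close> P by (intro frac_le power_mono) auto
  then show "\<rho> / (1 - \<rho>)\<^sup>2 \<le> a * P / e\<^sup>2"
    using P by (simp add: power2_eq_square field_simps)
qed

lemma hits_le_filter: "\<forall>t. k \<le> h t \<Longrightarrow> hits w h \<le> length (filter (\<lambda>x. k \<le> x) w)"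
proof (induction w arbitrary: h)
  case (Cons x w)
  have "hits w (\<lambda>t. h (Suc t)) \<le> length (filter (\<lambda>x. k \<le> x) w)"
    by (rule Cons.IH) (use Cons.prems in auto)
  then show ?case using Cons.prems by auto
qed simp

text \<open>A replacement can destroy a hit only where the original letter lies in the range of the
  path, so coins at letters below \<open>k\<close> need no correction.\<close>

lemma hits_replaced:
  assumes "\<forall>t. k \<le> h t"
  shows "hits (map fst zs) h \<le> hits (map (\<lambda>(x, b). if b then k else x) zs) h
     + length (filter (\<lambda>(x, b). b \<and> k \<le> x) zs)"
  using assms
proof (induction zs arbitrary: h)
  case (Cons z zs)
  have "hits (map fst zs) (\<lambda>t. h (Suc t)) \<le> hits (map (\<lambda>(x, b). if b then k else x) zs) (\<lambda>t. h (Suc t))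
     + length (filter (\<lambda>(x, b). b \<and> k \<le> x) zs)"
    by (rule Cons.IH) (use Cons.prems in auto)
  then show ?case using Cons.prems by (cases z) auto
qed simp

lemma hits_dropped:
  assumes "\<forall>t. 1 \<le> g t"
  shows "hits (map (\<lambda>(x, b). if x = k \<and> b \<or> k < x then 0 else x) zs) g \<le> hits (map fst zs) g"
  using assms
proof (induction zs arbitrary: g)
  case (Cons z zs)
  have "hits (map (\<lambda>(x, b). if x = k \<and> b \<or> k < x then 0 else x) zs) (\<lambda>t. g (Suc t))
      \<le> hits (map fst zs) (\<lambda>t. g (Suc t))"
    by (rule Cons.IH) (use Cons.prems in auto)
  moreover have "g 0 \<noteq> 0" using Cons.prems by (metis not_one_le_zero)
  ultimately show ?case by (cases z) auto
qed simp

lemma power2_sum4_le: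
  fixes a b c e :: real
  shows "(a + b + c + e)\<^sup>2 \<le> 4 * (a\<^sup>2 + b\<^sup>2 + c\<^sup>2 + e\<^sup>2)"
proof -
  have "0 \<le> (a - b)\<^sup>2 + (a - c)\<^sup>2 + (a - e)\<^sup>2 + (b - c)\<^sup>2 + (b - e)\<^sup>2 + (c - e)\<^sup>2"
    by (intro add_nonneg_nonneg) auto
  then show ?thesis by (simp add: power2_eq_square algebra_simps)
qed

lemma power2_sum3_le:
  fixes a b c :: real
  shows "(a + b + c)\<^sup>2 \<le> 3 * (a\<^sup>2 + b\<^sup>2 + c\<^sup>2)"
proof -
  have "0 \<le> (a - b)\<^sup>2 + (a - c)\<^sup>2 + (b - c)\<^sup>2"
    by (intro add_nonneg_nonneg) auto
  then show ?thesis by (simp add: power2_eq_square algebra_simps)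
qed

section \<open>Second moments of the two one-sided deviations\<close>

context
  fixes d k n :: nat and \<alpha> :: "nat \<Rightarrow> real" and A :: "nat pmf"
  assumes dist: "prob_dist_sorted d \<alpha>" and k: "k \<in> {1..d}"
    and A: "\<And>x. pmf A x = (if x \<in> {1..d} then \<alpha> x else 0)" and setA: "set_pmf A \<subseteq> {1..d}"
begin

lemma letter_prob_nonneg: "i \<in> {1..d} \<Longrightarrow> 0 \<le> \<alpha> i"
  using dist by (simp add: prob_dist_sorted_def)

lemma letter_prob_antimono: "1 \<le> i \<Longrightarrow> i \<le> j \<Longrightarrow> j \<le> d \<Longrightarrow> \<alpha> j \<le> \<alpha> i"
  using dist by (simp add: prob_dist_sorted_def)

lemma prob_tail: "measure_pmf.prob A {x. k \<le> x} = (\<Sum>j=k..d. \<alpha> j)"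
proof -
  have "measure_pmf.prob A {x. k \<le> x} = measure_pmf.prob A {k..d}"
    by (rule measure_prob_cong_0) (auto simp: A)
  also have "\<dots> = (\<Sum>j=k..d. \<alpha> j)"
    using k by (simp add: measure_measure_pmf_finite A)
  finally show ?thesis .
qed

lemma tail_bounds: "\<alpha> k \<le> (\<Sum>j=k..d. \<alpha> j)" "(\<Sum>j=k..d. \<alpha> j) \<le> 1" "0 \<le> \<alpha> k"
proof -
  show "\<alpha> k \<le> (\<Sum>j=k..d. \<alpha> j)"
    using k letter_prob_nonneg by (intro member_le_sum) auto
  show "(\<Sum>j=k..d. \<alpha> j) \<le> 1"
    using prob_tail measure_pmf.prob_le_1[of A] by metis
  show "0 \<le> \<alpha> k" using k letter_prob_nonneg by simp
qed

lemma letters: "w \<in> set_pmf (replicate_pmf n A) \<Longrightarrow> set w \<subseteq> {1..d}"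
  using setA by (auto simp: set_replicate_pmf lists_eq_set)

text \<open>The row is no longer than the number of letters at least \<open>k\<close>, a binomial
  variable. With \<open>s\<close> the tail and \<open>s * n \<le> 1\<close>, its second moment is at
  most \<open>2 * s * n\<close>.\<close>

lemma upper_small:
  assumes "(\<Sum>j=k..d. \<alpha> j) * real n \<le> 1"
  shows "(\<integral>\<^sup>+w. ennreal ((max 0 (real (shRSK w k) - \<alpha> k * real n))\<^sup>2) \<partial>replicate_pmf n A)
     \<le> ennreal (32 * (\<Sum>j=k..d. \<alpha> j) * real n)"
proof -
  define s where "s = (\<Sum>j=k..d. \<alpha> j)"
  have s: "0 \<le> s" using tail_bounds by (simp add: s_def)
  have "(\<integral>\<^sup>+w. ennreal ((max 0 (real (shRSK w k) - \<alpha> k * real n))\<^sup>2) \<partial>replicate_pmf n A)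
     \<le> (\<integral>\<^sup>+w. ennreal ((real (length (filter (\<lambda>x. k \<le> x) w)))\<^sup>2) \<partial>replicate_pmf n A)"
  proof (intro nn_integral_mono_AE AE_pmfI ennreal_leI power_mono)
    fix w assume w: "w \<in> set_pmf (replicate_pmf n A)"
    have "\<forall>x\<in>set w. 1 \<le> x" "1 \<le> k" using letters[OF w] k by auto
    then obtain h where h: "mono h" "\<forall>t. k \<le> h t" "shRSK w k \<le> hits w h"
      by (rule shRSK_upper)
    then have "real (shRSK w k) \<le> real (length (filter (\<lambda>x. k \<le> x) w))"
      using hits_le_filter[OF h(2), of w] by linarith
    then show "max 0 (real (shRSK w k) - \<alpha> k * real n) \<le> real (length (filter (\<lambda>x. k \<le> x) w))"
      using mult_nonneg_nonneg[OF tail_bounds(3) of_nat_0_le_iff[of n]] by linarith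
  qed auto
  also have "\<dots> = ennreal ((real n * s)\<^sup>2 + real n * (s * (1 - s)))"
    using moments_count[of n A "\<lambda>x. k \<le> x"] by (simp add: moments_def prob_tail s_def)
  also have "\<dots> \<le> ennreal (32 * s * real n)"
  proof (rule ennreal_leI)
    have "(real n * s)\<^sup>2 \<le> real n * s * 1"
      unfolding power2_eq_square using assms s by (intro mult_left_mono) (auto simp: s_def mult.commute)
    moreover have "real n * (s * (1 - s)) \<le> real n * s"
      using s by (intro mult_left_mono) (auto simp: algebra_simps)
    moreover have "0 \<le> real n * s" using s by simp
    ultimately show "(real n * s)\<^sup>2 + real n * (s * (1 - s)) \<le> 32 * s * real n"
      by (simp add: mult_ac)
  qed
  finally show ?thesis by (simp add: s_def)
qed

lemma upper_large:
  assumes large: "1 \<le> (\<Sum>j=k..d. \<alpha> j) * real n"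
  shows "(\<integral>\<^sup>+w. ennreal ((max 0 (real (shRSK w k) - \<alpha> k * real n))\<^sup>2) \<partial>replicate_pmf n A)
     \<le> ennreal (32 * (\<Sum>j=k..d. \<alpha> j) * real n)"
proof -
  define s where "s = (\<Sum>j=k..d. \<alpha> j)"
  define \<eta> where "\<eta> = sqrt (s / real n)"
  \<comment> \<open>Each letter is replaced by \<open>k\<close> with probability \<open>\<eta>\<close>; \<open>P\<close> is the resulting probability of \<open>k\<close>. The
    gap of at least \<open>\<eta>\<close> to the other letters makes the geometric laws exist, and \<open>\<eta>\<close> balances the
    shift \<open>\<eta> n\<close> of the mean against the bound \<open>s / \<eta>\<close> on the mean length of the stationary row.\<close>
  define P where "P = (1 - \<eta>) * \<alpha> k + \<eta>"
  define f where "f = (\<lambda>(x, b). if b then k else x :: nat)"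
  define B where "B = pair_pmf A (bernoulli_pmf \<eta>)"
  define Y where "Y = map_pmf f B"
  define r where "r = (\<lambda>i. (1 - \<eta>) * \<alpha> i / P)"
  define M where "M = Pi_pmf {k<..d} 0 (\<lambda>i. geometric_pmf (1 - r i))"
  define T where "T = (\<lambda>zs :: (nat \<times> bool) list. length (filter (\<lambda>(x, b). b \<and> k \<le> x) zs))"
  define R where "R = (\<lambda>(c, ys). count_list (snd (run (row_insert k) c ys)) k)"
  define C where "C = (\<lambda>c. \<Sum>i\<in>{k<..d}. c i :: nat)"
  note tb = tail_bounds[folded s_def]
  have n: "0 < real n" using large by (cases "n = 0") auto
  have s: "0 < s" "1 \<le> s * real n"
    using large zero_less_mult_pos2[of s "real n"] n by (auto simp: s_def)
  have \<eta>2: "\<eta>\<^sup>2 = s / real n" and \<eta>0: "0 < \<eta>" using s n by (auto simp: \<eta>_def)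
  \<comment> \<open>The assumption \<open>s * n \<ge> 1\<close> enters here; it makes
    \<open>\<eta>\<close> a probability and keeps \<open>P \<le> 2 * s\<close>.\<close>
  have \<eta>s: "\<eta> \<le> s"
  proof (rule power2_le_imp_le)
    have "s * 1 \<le> s * (s * real n)" using s by (intro mult_left_mono) auto
    then have "s / real n \<le> s\<^sup>2" using n by (simp add: divide_le_eq power2_eq_square mult.assoc)
    then show "\<eta>\<^sup>2 \<le> s\<^sup>2" by (simp only: \<eta>2)
  qed (use s in simp)
  have \<eta>1: "\<eta> \<le> 1" using \<eta>s tb by linarith
  have P: "0 < P" "P \<le> \<alpha> k + \<eta>" "P \<le> 2 * s"
  proof -
    have "0 \<le> (1 - \<eta>) * \<alpha> k" "(1 - \<eta>) * \<alpha> k \<le> 1 * \<alpha> k"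
      using \<eta>0 \<eta>1 tb mult_right_mono[of "1 - \<eta>" 1 "\<alpha> k"] by auto
    then show "0 < P" "P \<le> \<alpha> k + \<eta>" "P \<le> 2 * s" using \<eta>0 \<eta>s tb unfolding P_def by linarith+
  qed
  have pY: "pmf Y i = (1 - \<eta>) * \<alpha> i" if "i \<in> {k<..d}" for i
  proof -
    have "f -` {i} = {i} \<times> {False}" using that by (auto simp: f_def split: if_splits)
    then show ?thesis
      using that k \<eta>0 \<eta>1 by (simp add: Y_def B_def pmf_map measure_pmf_single pmf_pair A)
  qed
  have pYk: "pmf Y k = P"
  proof -
    have "f -` {k} = UNIV \<times> {True} \<union> {k} \<times> {False}" by (auto simp: f_def split: if_splits)
    moreover have "measure_pmf.prob B (UNIV \<times> {True} \<union> {k} \<times> {False}) =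
        measure_pmf.prob B (UNIV \<times> {True}) + measure_pmf.prob B ({k} \<times> {False})"
      by (rule measure_pmf.finite_measure_Union) auto
    ultimately show ?thesis
      using k \<eta>0 \<eta>1 by (simp add: Y_def pmf_map) (simp add: B_def measure_pmf_prob_product measure_pmf_single pmf_pair A P_def)
  qed
  have r: "0 \<le> r i" "r i < 1" "r i / (1 - r i) \<le> \<alpha> i / \<eta>" "r i / (1 - r i)\<^sup>2 \<le> \<alpha> i * P / \<eta>\<^sup>2"
    if i: "i \<in> {k<..d}" for i
  proof -
    have a: "0 \<le> \<alpha> i" "\<alpha> i \<le> \<alpha> k" using i k letter_prob_nonneg letter_prob_antimono by auto
    \<comment> \<open>The ordering of \<open>\<alpha>\<close> yields the rate gap
      \<open>\<eta>\<close> between \<open>k\<close> and every larger letter.\<close>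
    then have b: "0 \<le> (1 - \<eta>) * \<alpha> i" "(1 - \<eta>) * \<alpha> i \<le> \<alpha> i" "(1 - \<eta>) * \<alpha> i + \<eta> \<le> P"
      using \<eta>0 \<eta>1 by (auto simp: P_def mult_left_mono mult_left_le_one_le)
    show r0: "0 \<le> r i" using b P by (simp add: r_def)
    note rb = ratio_bounds[OF r0 eq_refl[OF fun_cong[OF r_def]] b(1) \<eta>0 b(3)]
    show "r i < 1" by (rule rb)
    show "r i / (1 - r i) \<le> \<alpha> i / \<eta>"
      using rb(2) divide_right_mono[OF b(2), of \<eta>] \<eta>0 by linarith
    have "(1 - \<eta>) * \<alpha> i * P / \<eta>\<^sup>2 \<le> \<alpha> i * P / \<eta>\<^sup>2"
      using b(2) P by (intro divide_right_mono mult_right_mono) auto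
    then show "r i / (1 - r i)\<^sup>2 \<le> \<alpha> i * P / \<eta>\<^sup>2" using rb(3) by linarith
  qed
  have inv: "map_pmf (row_insert k) (pair_pmf M Y) = pair_pmf M Y"
    unfolding M_def
  proof (rule row_insert_invariant)
    show "0 \<le> r i \<and> r i < 1 \<and> pmf Y i = pmf Y k * r i" if "i \<in> {k<..d}" for i
      using r[OF that] pY[OF that] pYk P by (simp add: r_def)
    show "set_pmf Y \<subseteq> {..d}" using setA k by (auto simp: Y_def B_def f_def)
  qed
  have Q: "pair_pmf M (replicate_pmf n Y) = map_pmf (apsnd (map f)) (pair_pmf M (replicate_pmf n B))"
    by (simp add: Y_def replicate_map_pmf pair_map_pmf2)
  have W: "replicate_pmf n A = map_pmf (\<lambda>(c, zs). map fst zs) (pair_pmf M (replicate_pmf n B))"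
    unfolding B_def by (rule replicate_pmf_first)
  have iR: "(\<integral>\<^sup>+(c, zs). ennreal ((real (R (c, map f zs)) - real n * P)\<^sup>2) \<partial>pair_pmf M (replicate_pmf n B))
      = ennreal (real n * (P * (1 - P)))"
    using moments_centered[OF moments_outputs[OF inv, of n k]]
    by (simp add: pYk Q R_def case_prod_unfold)
  have pT: "measure_pmf.prob B {x. case x of (x, b) \<Rightarrow> b \<and> k \<le> x} = s * \<eta>"
  proof -
    have "{x. case x of (x, b) \<Rightarrow> b \<and> k \<le> x} = {x. k \<le> x} \<times> {True}" by auto
    then show ?thesis
      using \<eta>0 \<eta>1 by (simp add: B_def measure_pmf_prob_product prob_tail measure_pmf_single s_def)
  qed
  have iT: "(\<integral>\<^sup>+(c, zs). ennreal ((real (T zs))\<^sup>2) \<partial>pair_pmf M (replicate_pmf n B))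
      = ennreal ((real n * (s * \<eta>))\<^sup>2 + real n * (s * \<eta> * (1 - s * \<eta>)))"
    using moments_count[of n B "\<lambda>(x, b). b \<and> k \<le> x"]
    by (simp add: nn_integral_pair_pmf' moments_def T_def pT)
  have iC: "(\<integral>\<^sup>+(c, zs). ennreal ((real (C c))\<^sup>2) \<partial>pair_pmf M (replicate_pmf n B))
      = ennreal ((\<Sum>i\<in>{k<..d}. r i / (1 - r i))\<^sup>2 + (\<Sum>i\<in>{k<..d}. r i / (1 - r i)\<^sup>2))"
    using moments_geometric_sum[of "{k<..d}" r] r
    by (simp add: nn_integral_pair_pmf' moments_def C_def M_def)
  have pointwise: "(max 0 (real (shRSK (map fst zs) k) - \<alpha> k * real n))\<^sup>2 \<le>
      4 * ((real (T zs))\<^sup>2 + (real (R (c, map f zs)) - real n * P)\<^sup>2 + (real (C c))\<^sup>2 + (\<eta> * real n)\<^sup>2)"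
    if "(c, zs) \<in> set_pmf (pair_pmf M (replicate_pmf n B))" for c zs
  proof -
    have zs: "set (map fst zs) \<subseteq> {1..d}" "c \<in> set_pmf M"
      using that setA by (auto simp: set_replicate_pmf lists_eq_set B_def)
    have supp: "\<forall>i. i \<notin> {k<..d} \<longrightarrow> c i = 0"
      using zs(2) set_Pi_pmf_subset[of "{k<..d}" 0] unfolding M_def by fastforce
    have "\<forall>x\<in>set (map fst zs). 1 \<le> x" "1 \<le> k" using zs(1) k by auto
    then obtain h where h: "mono h" "\<forall>t. k \<le> h t" "shRSK (map fst zs) k \<le> hits (map fst zs) h"
      by (rule shRSK_upper)
    have "set (map f zs) \<subseteq> {..d}" using zs(1) k by (force simp: f_def)
    then have "hits (map f zs) h \<le> R (c, map f zs) + C c"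
      using row_insert_hits[OF h(1,2) order_refl supp] by (simp add: R_def C_def)
    moreover have "hits (map fst zs) h \<le> hits (map f zs) h + T zs"
      using hits_replaced[OF h(2), of zs] by (simp add: f_def T_def)
    ultimately have "real (shRSK (map fst zs) k) \<le> real (T zs) + real (R (c, map f zs)) + real (C c)"
      using h(3) by linarith
    moreover have "real n * P \<le> \<alpha> k * real n + \<eta> * real n"
      using mult_left_mono[OF P(2), of "real n"] by (simp add: algebra_simps)
    moreover have "0 \<le> \<eta> * real n" using \<eta>0 by simp
    ultimately have "max 0 (real (shRSK (map fst zs) k) - \<alpha> k * real n) \<le>
        real (T zs) + \<bar>real (R (c, map f zs)) - real n * P\<bar> + real (C c) + \<eta> * real n"
      by linarith
    then have "(max 0 (real (shRSK (map fst zs) k) - \<alpha> k * real n))\<^sup>2 \<le>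
        (real (T zs) + \<bar>real (R (c, map f zs)) - real n * P\<bar> + real (C c) + \<eta> * real n)\<^sup>2"
      by (intro power_mono) auto
    also have "\<dots> \<le> 4 * ((real (T zs))\<^sup>2 + (\<bar>real (R (c, map f zs)) - real n * P\<bar>)\<^sup>2 + (real (C c))\<^sup>2 + (\<eta> * real n)\<^sup>2)"
      by (rule power2_sum4_le)
    finally show ?thesis by simp
  qed
  have "(\<integral>\<^sup>+w. ennreal ((max 0 (real (shRSK w k) - \<alpha> k * real n))\<^sup>2) \<partial>replicate_pmf n A) =
      (\<integral>\<^sup>+(c, zs). ennreal ((max 0 (real (shRSK (map fst zs) k) - \<alpha> k * real n))\<^sup>2) \<partial>pair_pmf M (replicate_pmf n B))"
    by (simp add: W case_prod_unfold)
  also have "\<dots> \<le> (\<integral>\<^sup>+x. ennreal 4 * ((case x of (c, zs) \<Rightarrow> ennreal ((real (T zs))\<^sup>2)) +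
      (case x of (c, zs) \<Rightarrow> ennreal ((real (R (c, map f zs)) - real n * P)\<^sup>2)) +
      (case x of (c, zs) \<Rightarrow> ennreal ((real (C c))\<^sup>2)) + ennreal ((\<eta> * real n)\<^sup>2)) \<partial>pair_pmf M (replicate_pmf n B))"
  proof (intro nn_integral_mono_AE AE_pmfI)
    fix x assume "x \<in> set_pmf (pair_pmf M (replicate_pmf n B))"
    moreover obtain c zs where "x = (c, zs)" by (cases x)
    ultimately show "(case x of (c, zs) \<Rightarrow> ennreal ((max 0 (real (shRSK (map fst zs) k) - \<alpha> k * real n))\<^sup>2))
        \<le> ennreal 4 * ((case x of (c, zs) \<Rightarrow> ennreal ((real (T zs))\<^sup>2)) +
      (case x of (c, zs) \<Rightarrow> ennreal ((real (R (c, map f zs)) - real n * P)\<^sup>2)) +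
      (case x of (c, zs) \<Rightarrow> ennreal ((real (C c))\<^sup>2)) + ennreal ((\<eta> * real n)\<^sup>2))"
      using ennreal_leI[OF pointwise[of c zs]] by (simp add: ennreal_mult ennreal_plus)
  qed
  also have "\<dots> = ennreal 4 * (ennreal ((real n * (s * \<eta>))\<^sup>2 + real n * (s * \<eta> * (1 - s * \<eta>))) +
      ennreal (real n * (P * (1 - P))) +
      ennreal ((\<Sum>i\<in>{k<..d}. r i / (1 - r i))\<^sup>2 + (\<Sum>i\<in>{k<..d}. r i / (1 - r i)\<^sup>2)) +
      ennreal ((\<eta> * real n)\<^sup>2))"
    by (subst nn_integral_cmult, simp, subst nn_integral_add, simp, simp, subst nn_integral_add,
        simp, simp, subst nn_integral_add, simp, simp, simp only: iT iR iC) simp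
  \<comment> \<open>In units of \<open>s * n\<close>, coin correction, output fluctuation, initial
    content and drift contribute 2, 2, 3 and 1; the factor 4 from squaring a sum of four terms gives
    32.\<close>
  also have "\<dots> \<le> ennreal 4 * (ennreal (2 * (s * real n)) + ennreal (2 * (s * real n)) +
      ennreal (3 * (s * real n)) + ennreal (s * real n))"
  proof (intro mult_left_mono add_mono ennreal_leI)
    have sum_le: "(\<Sum>i\<in>{k<..d}. \<alpha> i) \<le> s"
      unfolding s_def using k letter_prob_nonneg by (intro sum_mono2) auto
    have e: "real n * \<eta>\<^sup>2 = s" using \<eta>2 n by simp
    have "(real n * (s * \<eta>))\<^sup>2 = real n * s\<^sup>2 * (real n * \<eta>\<^sup>2)"
      by (simp add: power_mult_distrib power2_eq_square mult_ac)
    also have "\<dots> = (s * real n) * s\<^sup>2" unfolding e by simp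
    also have "\<dots> \<le> (s * real n) * 1"
      using s tb by (intro mult_left_mono) (auto simp: power_le_one)
    finally have 1: "(real n * (s * \<eta>))\<^sup>2 \<le> s * real n" by simp
    have "s * \<eta> * (1 - s * \<eta>) \<le> s * 1"
      using s \<eta>0 \<eta>1 tb by (intro mult_mono[of "s * \<eta>" s "1 - s * \<eta>" 1]) (auto simp: mult_le_one)
    then have "real n * (s * \<eta> * (1 - s * \<eta>)) \<le> s * real n"
      using n by (simp add: mult.commute)
    then show "(real n * (s * \<eta>))\<^sup>2 + real n * (s * \<eta> * (1 - s * \<eta>)) \<le> 2 * (s * real n)"
      using 1 by linarith
    have "P * (1 - P) \<le> P" using P by (simp add: algebra_simps)
    then show "real n * (P * (1 - P)) \<le> 2 * (s * real n)"
      using P(3) n by simp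
    have m: "(\<Sum>i\<in>{k<..d}. r i / (1 - r i)) \<le> s / \<eta>"
    proof -
      have "(\<Sum>i\<in>{k<..d}. r i / (1 - r i)) \<le> (\<Sum>i\<in>{k<..d}. \<alpha> i / \<eta>)"
        by (intro sum_mono r)
      also have "\<dots> \<le> s / \<eta>"
        using sum_le \<eta>0 by (simp add: divide_right_mono flip: sum_divide_distrib)
      finally show ?thesis .
    qed
    have "(\<Sum>i\<in>{k<..d}. r i / (1 - r i))\<^sup>2 \<le> (s / \<eta>)\<^sup>2"
      using m r(1,2) by (intro power_mono sum_nonneg divide_nonneg_nonneg) (auto simp: less_imp_le)
    also have "\<dots> = s * real n"
      unfolding power_divide \<eta>2 using s n by (simp add: power2_eq_square)
    finally have m2: "(\<Sum>i\<in>{k<..d}. r i / (1 - r i))\<^sup>2 \<le> s * real n" .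
    have "(\<Sum>i\<in>{k<..d}. r i / (1 - r i)\<^sup>2) \<le> (\<Sum>i\<in>{k<..d}. \<alpha> i * P / \<eta>\<^sup>2)"
      by (intro sum_mono r)
    also have "\<dots> = (\<Sum>i\<in>{k<..d}. \<alpha> i) * (P / \<eta>\<^sup>2)"
      by (simp add: sum_distrib_right sum_divide_distrib)
    also have "\<dots> \<le> s * (P / \<eta>\<^sup>2)"
      using sum_le P by (intro mult_right_mono) auto
    also have "\<dots> = real n * P" using s n by (simp add: \<eta>2)
    also have "\<dots> \<le> real n * (2 * s)" using P(3) n by (intro mult_left_mono) auto
    finally show "(\<Sum>i\<in>{k<..d}. r i / (1 - r i))\<^sup>2 + (\<Sum>i\<in>{k<..d}. r i / (1 - r i)\<^sup>2) \<le> 3 * (s * real n)"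
      using m2 by (simp add: mult_ac)
    show "(\<eta> * real n)\<^sup>2 \<le> s * real n"
      unfolding power_mult_distrib \<eta>2 using n by (simp add: power2_eq_square)
  qed simp
  also have "\<dots> = ennreal (32 * s * real n)"
    using s n by (simp flip: ennreal_plus ennreal_mult ennreal_numeral)
  finally show ?thesis by (simp add: s_def)
qed

text \<open>The deficit never exceeds \<open>\<alpha> k * n\<close>, whose square is at most
  \<open>k * \<alpha> k * n\<close> here.\<close>

lemma lower_small:
  assumes "\<alpha> k * real n \<le> real k"
  shows "(\<integral>\<^sup>+w. ennreal ((max 0 (\<alpha> k * real n - real (shRSK w k)))\<^sup>2) \<partial>replicate_pmf n A)
     \<le> ennreal (12 * (real k * \<alpha> k * real n))"
proof -
  have nn: "0 \<le> \<alpha> k * real n" using tail_bounds(3) by simp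
  have "(max 0 (\<alpha> k * real n - real (shRSK w k)))\<^sup>2 \<le> 12 * (real k * \<alpha> k * real n)" for w
  proof -
    have "(max 0 (\<alpha> k * real n - real (shRSK w k)))\<^sup>2 \<le> (\<alpha> k * real n)\<^sup>2"
      using nn by (intro power_mono) auto
    also have "\<dots> \<le> real k * (\<alpha> k * real n)"
      unfolding power2_eq_square using assms nn by (intro mult_right_mono) auto
    also have "\<dots> \<le> 12 * (real k * (\<alpha> k * real n))"
      using mult_nonneg_nonneg[OF of_nat_0_le_iff[of k] nn] by linarith
    finally show ?thesis by (simp add: mult.assoc)
  qed
  then have "(\<integral>\<^sup>+w. ennreal ((max 0 (\<alpha> k * real n - real (shRSK w k)))\<^sup>2) \<partial>replicate_pmf n A)
      \<le> (\<integral>\<^sup>+w. ennreal (12 * (real k * \<alpha> k * real n)) \<partial>replicate_pmf n A)"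
    by (intro nn_integral_mono ennreal_leI)
  then show ?thesis by simp
qed

lemma lower_large:
  assumes large: "real k < \<alpha> k * real n"
  shows "(\<integral>\<^sup>+w. ennreal ((max 0 (\<alpha> k * real n - real (shRSK w k)))\<^sup>2) \<partial>replicate_pmf n A)
     \<le> ennreal (12 * (real k * \<alpha> k * real n))"
proof -
  define q where "q = \<alpha> k"
  define \<delta> where "\<delta> = sqrt (real k * q / real n)"
  \<comment> \<open>Each \<open>k\<close> is dropped with probability \<open>\<delta> / q\<close>, so that arrivals are rarer by \<open>\<delta>\<close> than services;
    \<open>\<delta>\<close> balances the loss \<open>\<delta> n\<close> against the bound \<open>k q / \<delta>\<close> on the mean number of queued customers.\<close>
  define a where "a = q - \<delta>"
  define f where "f = (\<lambda>(x, b). if x = k \<and> b \<or> k < x then 0 else x :: nat)"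
  define B where "B = pair_pmf A (bernoulli_pmf (\<delta> / q))"
  define Y where "Y = map_pmf f B"
  define r where "r = (\<lambda>i. a / \<alpha> i)"
  define M where "M = Pi_pmf {1..<k} 0 (\<lambda>i. geometric_pmf (1 - r i))"
  define R where "R = (\<lambda>(c, ys). count_list (snd (run (tandem k) c ys)) k)"
  define C where "C = (\<lambda>c. \<Sum>i\<in>{1..<k}. c i :: nat)"
  have k1: "1 \<le> k" "k \<le> d" using k by auto
  have n: "0 < real n" using large k1 by (cases "n = 0") auto
  have "0 < \<alpha> k * real n" using large k1 by linarith
  then have q: "0 < q" using n zero_less_mult_pos2[of q "real n"] by (simp add: q_def)
  have \<delta>2: "\<delta>\<^sup>2 = real k * q / real n" and \<delta>0: "0 < \<delta>" using q n k1 by (auto simp: \<delta>_def)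
  \<comment> \<open>By \<open>k < q * n\<close> the coin probability \<open>\<delta> / q\<close> is
    below one and the arrival rate \<open>a\<close> stays positive.\<close>
  have \<delta>q: "\<delta> < q"
  proof (rule power2_less_imp_less)
    have "q * real k < q * (q * real n)" using q large by (simp add: q_def)
    then have "real k * q / real n < q\<^sup>2"
      using n by (simp add: divide_less_eq power2_eq_square mult_ac)
    then show "\<delta>\<^sup>2 < q\<^sup>2" by (simp only: \<delta>2)
  qed (use q in simp)
  have a: "0 < a" "a \<le> q" "a + \<delta> = q" using \<delta>q \<delta>0 by (auto simp: a_def)
  have aq: "q \<le> \<alpha> i" if "i \<in> {1..<k}" for i
    using that k1 letter_prob_antimono[of i k] by (auto simp: q_def)
  have pY: "pmf Y i = \<alpha> i" if "i \<in> {1..<k}" for i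
  proof -
    have "f -` {i} = {i} \<times> UNIV" using that by (auto simp: f_def split: if_splits)
    then show ?thesis
      using that k1 by (simp add: Y_def B_def pmf_map measure_pmf_prob_product measure_pmf_single A)
  qed
  have pYk: "pmf Y k = a"
  proof -
    have "f -` {k} = {k} \<times> {False}" using k1 by (auto simp: f_def split: if_splits)
    moreover have "\<delta> / q \<le> 1" "0 \<le> \<delta> / q" using \<delta>q \<delta>0 q by auto
    ultimately show ?thesis
      using k1 q by (simp add: Y_def B_def pmf_map measure_pmf_single pmf_pair A a_def field_simps flip: q_def)
  qed
  have r: "0 \<le> r i" "r i < 1" "r i / (1 - r i) \<le> a / \<delta>" "r i / (1 - r i)\<^sup>2 \<le> a * q / \<delta>\<^sup>2"
    if i: "i \<in> {1..<k}" for i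
  proof -
    show r0: "0 \<le> r i" using a q aq[OF i] by (simp add: r_def)
    have r1: "r i \<le> a / q" unfolding r_def using a q aq[OF i] by (intro divide_left_mono) auto
    show "r i < 1" "r i / (1 - r i) \<le> a / \<delta>" "r i / (1 - r i)\<^sup>2 \<le> a * q / \<delta>\<^sup>2"
      using ratio_bounds[OF r0 r1 _ \<delta>0] a by auto
  qed
  have inv: "map_pmf (tandem k) (pair_pmf M Y) = pair_pmf M Y"
    unfolding M_def
  proof (rule tandem_invariant[OF _ _ k1(1)])
    show "0 \<le> r i \<and> r i < 1 \<and> pmf Y k = pmf Y i * r i" if "i \<in> {1..<k}" for i
      using r[OF that] pY[OF that] pYk aq[OF that] q by (simp add: r_def)
    show "set_pmf Y \<subseteq> {..k}" by (auto simp: Y_def f_def)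
  qed
  have Q: "pair_pmf M (replicate_pmf n Y) = map_pmf (apsnd (map f)) (pair_pmf M (replicate_pmf n B))"
    by (simp add: Y_def replicate_map_pmf pair_map_pmf2)
  have W: "replicate_pmf n A = map_pmf (\<lambda>(c, zs). map fst zs) (pair_pmf M (replicate_pmf n B))"
    unfolding B_def by (rule replicate_pmf_first)
  have iR: "(\<integral>\<^sup>+(c, zs). ennreal ((real (R (c, map f zs)) - real n * a)\<^sup>2) \<partial>pair_pmf M (replicate_pmf n B))
      = ennreal (real n * (a * (1 - a)))"
    using moments_centered[OF moments_outputs[OF inv, of n k]]
    by (simp add: pYk Q R_def case_prod_unfold)
  have iC: "(\<integral>\<^sup>+(c, zs). ennreal ((real (C c))\<^sup>2) \<partial>pair_pmf M (replicate_pmf n B))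
      = ennreal ((\<Sum>i\<in>{1..<k}. r i / (1 - r i))\<^sup>2 + (\<Sum>i\<in>{1..<k}. r i / (1 - r i)\<^sup>2))"
    using moments_geometric_sum[of "{1..<k}" r] r
    by (simp add: nn_integral_pair_pmf' moments_def C_def M_def)
  have pointwise: "(max 0 (q * real n - real (shRSK (map fst zs) k)))\<^sup>2 \<le>
      3 * ((real (R (c, map f zs)) - real n * a)\<^sup>2 + (real (C c))\<^sup>2 + (\<delta> * real n)\<^sup>2)"
    if "(c, zs) \<in> set_pmf (pair_pmf M (replicate_pmf n B))" for c zs
  proof -
    have "set (map fst zs) \<subseteq> {1..d}"
      using that setA by (auto simp: set_replicate_pmf lists_eq_set B_def)
    then have "\<forall>x\<in>set (map fst zs). 1 \<le> x" by auto
    then obtain g where g: "antimono g" "\<forall>t. 1 \<le> g t \<and> g t \<le> k" "hits (map fst zs) g \<le> shRSK (map fst zs) k"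
      using k1(1) by (rule shRSK_lower)
    have "set (map f zs) \<subseteq> {..k}" by (auto simp: f_def)
    then have "R (c, map f zs) \<le> hits (map f zs) g + C c"
      using tandem_hits[OF g(1,2) order_refl] by (simp add: R_def C_def)
    moreover have "hits (map f zs) g \<le> hits (map fst zs) g"
      unfolding f_def using g(2) by (intro hits_dropped) auto
    ultimately have "real (R (c, map f zs)) \<le> real (shRSK (map fst zs) k) + real (C c)"
      using g(3) by linarith
    moreover have "q * real n = real n * a + \<delta> * real n"
      by (simp add: a_def algebra_simps)
    moreover have "0 \<le> \<delta> * real n" using \<delta>0 by simp
    ultimately have "max 0 (q * real n - real (shRSK (map fst zs) k)) \<le>
        \<bar>real (R (c, map f zs)) - real n * a\<bar> + real (C c) + \<delta> * real n"
      by linarith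
    then have "(max 0 (q * real n - real (shRSK (map fst zs) k)))\<^sup>2 \<le>
        (\<bar>real (R (c, map f zs)) - real n * a\<bar> + real (C c) + \<delta> * real n)\<^sup>2"
      by (intro power_mono) auto
    also have "\<dots> \<le> 3 * ((\<bar>real (R (c, map f zs)) - real n * a\<bar>)\<^sup>2 + (real (C c))\<^sup>2 + (\<delta> * real n)\<^sup>2)"
      by (rule power2_sum3_le)
    finally show ?thesis by simp
  qed
  have "(\<integral>\<^sup>+w. ennreal ((max 0 (\<alpha> k * real n - real (shRSK w k)))\<^sup>2) \<partial>replicate_pmf n A) =
      (\<integral>\<^sup>+(c, zs). ennreal ((max 0 (q * real n - real (shRSK (map fst zs) k)))\<^sup>2) \<partial>pair_pmf M (replicate_pmf n B))"
    by (simp add: W case_prod_unfold q_def)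
  also have "\<dots> \<le> (\<integral>\<^sup>+x. ennreal 3 * (
      (case x of (c, zs) \<Rightarrow> ennreal ((real (R (c, map f zs)) - real n * a)\<^sup>2)) +
      (case x of (c, zs) \<Rightarrow> ennreal ((real (C c))\<^sup>2)) + ennreal ((\<delta> * real n)\<^sup>2)) \<partial>pair_pmf M (replicate_pmf n B))"
  proof (intro nn_integral_mono_AE AE_pmfI)
    fix x assume "x \<in> set_pmf (pair_pmf M (replicate_pmf n B))"
    moreover obtain c zs where "x = (c, zs)" by (cases x)
    ultimately show "(case x of (c, zs) \<Rightarrow> ennreal ((max 0 (q * real n - real (shRSK (map fst zs) k)))\<^sup>2))
        \<le> ennreal 3 * (
      (case x of (c, zs) \<Rightarrow> ennreal ((real (R (c, map f zs)) - real n * a)\<^sup>2)) +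
      (case x of (c, zs) \<Rightarrow> ennreal ((real (C c))\<^sup>2)) + ennreal ((\<delta> * real n)\<^sup>2))"
      using ennreal_leI[OF pointwise[of c zs]] by (simp add: ennreal_mult ennreal_plus)
  qed
  also have "\<dots> = ennreal 3 * (ennreal (real n * (a * (1 - a))) +
      ennreal ((\<Sum>i\<in>{1..<k}. r i / (1 - r i))\<^sup>2 + (\<Sum>i\<in>{1..<k}. r i / (1 - r i)\<^sup>2)) +
      ennreal ((\<delta> * real n)\<^sup>2))"
    by (subst nn_integral_cmult, simp, subst nn_integral_add, simp, simp, subst nn_integral_add,
        simp, simp, simp only: iR iC) simp
  \<comment> \<open>In units of \<open>k * q * n\<close>, output fluctuation, initial content and
    drift contribute 1, 2 and 1; the factor 3 from squaring three terms gives 12.\<close>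
  also have "\<dots> \<le> ennreal 3 * (ennreal (real k * q * real n) + ennreal (2 * (real k * q * real n)) +
      ennreal (real k * q * real n))"
  proof (intro mult_left_mono add_mono ennreal_leI)
    have kq: "real n * q \<le> real k * q * real n"
      using k1 q n by simp
    have "a * (1 - a) \<le> a * 1" using a by (intro mult_left_mono) auto
    then have "a * (1 - a) \<le> q" using a by linarith
    then have "real n * (a * (1 - a)) \<le> real n * q" using n by (intro mult_left_mono) auto
    then show "real n * (a * (1 - a)) \<le> real k * q * real n" using kq by linarith
    have "(\<Sum>i\<in>{1..<k}. r i / (1 - r i)) \<le> (\<Sum>i\<in>{1..<k}. q / \<delta>)"
      using r(3) a \<delta>0 by (intro sum_mono) (meson divide_right_mono less_imp_le order_trans)
    also have "\<dots> \<le> real k * (q / \<delta>)"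
      using q \<delta>0 by (auto intro!: mult_right_mono divide_right_mono)
    finally have "(\<Sum>i\<in>{1..<k}. r i / (1 - r i))\<^sup>2 \<le> (real k * (q / \<delta>))\<^sup>2"
      using r(1,2) by (intro power_mono sum_nonneg divide_nonneg_nonneg) (auto simp: less_imp_le)
    also have "\<dots> = real k * q * real n"
      unfolding power_mult_distrib power_divide \<delta>2 using q n k1 by (simp add: power2_eq_square)
    finally have m2: "(\<Sum>i\<in>{1..<k}. r i / (1 - r i))\<^sup>2 \<le> real k * q * real n" .
    have "(\<Sum>i\<in>{1..<k}. r i / (1 - r i)\<^sup>2) \<le> (\<Sum>i\<in>{1..<k}. q * q / \<delta>\<^sup>2)"
    proof (rule sum_mono)
      fix i assume "i \<in> {1..<k}"
      then have "r i / (1 - r i)\<^sup>2 \<le> a * q / \<delta>\<^sup>2" by (rule r(4))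
      also have "\<dots> \<le> q * q / \<delta>\<^sup>2" using a q by (intro divide_right_mono mult_right_mono) auto
      finally show "r i / (1 - r i)\<^sup>2 \<le> q * q / \<delta>\<^sup>2" .
    qed
    also have "\<dots> \<le> real k * (q * q / \<delta>\<^sup>2)"
      using q by (auto intro!: mult_right_mono divide_right_mono)
    also have "\<dots> = real n * q"
      using q n k1 by (simp add: \<delta>2)
    finally show "(\<Sum>i\<in>{1..<k}. r i / (1 - r i))\<^sup>2 + (\<Sum>i\<in>{1..<k}. r i / (1 - r i)\<^sup>2)
        \<le> 2 * (real k * q * real n)"
      using m2 kq by linarith
    show "(\<delta> * real n)\<^sup>2 \<le> real k * q * real n"
      unfolding power_mult_distrib \<delta>2 using n by (simp add: power2_eq_square)
  qed simp
  also have "\<dots> = ennreal (12 * (real k * q * real n))"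
    using q n by (simp flip: ennreal_plus ennreal_mult ennreal_numeral)
  finally show ?thesis by (simp add: q_def)
qed

text \<open>The square of the deviation is the sum of the squares of its positive and negative
  parts, so the one-sided bounds simply add.\<close>

lemma second_moment:
  "word_expect d \<alpha> n (\<lambda>w. (real (shRSK w k) - \<alpha> k * real n)\<^sup>2)
     \<le> 32 * (\<Sum>j=k..d. \<alpha> j) * real n + 12 * (real k * \<alpha> k * real n)"
proof -
  let ?X = "\<lambda>w. real (shRSK w k) - \<alpha> k * real n"
  have nn: "0 \<le> 32 * (\<Sum>j=k..d. \<alpha> j) * real n" "0 \<le> 12 * (real k * \<alpha> k * real n)"
    using tail_bounds by auto
  have "ennreal (word_expect d \<alpha> n (\<lambda>w. (?X w)\<^sup>2)) = (\<integral>\<^sup>+w. ennreal ((?X w)\<^sup>2) \<partial>replicate_pmf n A)"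
    by (rule word_expect_nn_integral[OF A setA]) simp
  also have "\<dots> = (\<integral>\<^sup>+w. ennreal ((max 0 (?X w))\<^sup>2) + ennreal ((max 0 (\<alpha> k * real n - real (shRSK w k)))\<^sup>2)
      \<partial>replicate_pmf n A)"
    by (intro nn_integral_cong) (simp add: max_def power2_commute)
  also have "\<dots> = (\<integral>\<^sup>+w. ennreal ((max 0 (?X w))\<^sup>2) \<partial>replicate_pmf n A) +
      (\<integral>\<^sup>+w. ennreal ((max 0 (\<alpha> k * real n - real (shRSK w k)))\<^sup>2) \<partial>replicate_pmf n A)"
    by (rule nn_integral_add) auto
  also have "\<dots> \<le> ennreal (32 * (\<Sum>j=k..d. \<alpha> j) * real n) + ennreal (12 * (real k * \<alpha> k * real n))"
    using upper_small upper_large lower_small lower_large by (intro add_mono) (meson linear not_le)+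
  also have "\<dots> = ennreal (32 * (\<Sum>j=k..d. \<alpha> j) * real n + 12 * (real k * \<alpha> k * real n))"
    by (rule ennreal_plus[OF nn, symmetric])
  finally show ?thesis using nn by (subst (asm) ennreal_le_iff) auto
qed

text \<open>Sortedness gives
  \<open>k * \<alpha> k \<le> \<alpha> 1 + ... + \<alpha> k \<le> 1\<close> and bounds each of the
  at most \<open>d\<close> tail terms by \<open>\<alpha> k\<close>.\<close>

lemma tail_le_min: "real k * \<alpha> k \<le> min 1 (\<alpha> k * real d)" "(\<Sum>j=k..d. \<alpha> j) \<le> min 1 (\<alpha> k * real d)"
proof -
  have "real k * \<alpha> k = (\<Sum>j=1..k. \<alpha> k)" by simp
  also have "\<dots> \<le> (\<Sum>j=1..k. \<alpha> j)" using k letter_prob_antimono by (intro sum_mono) auto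
  also have "\<dots> \<le> (\<Sum>j=1..d. \<alpha> j)" using k letter_prob_nonneg by (intro sum_mono2) auto
  also have "\<dots> = 1" using dist by (simp add: prob_dist_sorted_def)
  finally have "real k * \<alpha> k \<le> 1" .
  moreover have "real k * \<alpha> k \<le> \<alpha> k * real d"
    using k mult_right_mono[OF _ tail_bounds(3), of "real k" "real d"] by (simp add: mult.commute)
  ultimately show "real k * \<alpha> k \<le> min 1 (\<alpha> k * real d)" by simp
  have "(\<Sum>j=k..d. \<alpha> j) \<le> (\<Sum>j=k..d. \<alpha> k)" using k letter_prob_antimono by (intro sum_mono) auto
  also have "\<dots> = \<alpha> k * real (Suc d - k)" by simp
  also have "\<dots> \<le> \<alpha> k * real d" using k tail_bounds(3) by (intro mult_left_mono) auto
  finally show "(\<Sum>j=k..d. \<alpha> j) \<le> min 1 (\<alpha> k * real d)" using tail_bounds(2) by simp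
qed

end

text \<open>Both 32 and 12 are below 42, and 84 is 42 + 42, one share for each of the two terms
  bounded by the minimum.\<close>

lemma SW_second_moment:
  assumes "prob_dist_sorted d \<alpha>" "k \<in> {1..d}"
  shows "word_expect d \<alpha> n (\<lambda>w. (real (shRSK w k) - \<alpha> k * real n)\<^sup>2)
     \<le> 42 * \<alpha> k * real k * real n + 42 * (\<Sum>j=k..d. \<alpha> j) * real n" (is ?A)
    and "42 * \<alpha> k * real k * real n + 42 * (\<Sum>j=k..d. \<alpha> j) * real n
     \<le> 84 * min 1 (\<alpha> k * real d) * real n" (is ?B)
proof -
  obtain A where A: "\<And>x. pmf A x = (if x \<in> {1..d} then \<alpha> x else 0)" "set_pmf A \<subseteq> {1..d}"
    using letter_law[OF assms(1)] by blast
  note ctx = assms A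
  have "0 \<le> \<alpha> k" "0 \<le> (\<Sum>j=k..d. \<alpha> j)"
    using tail_bounds(1,3)[OF ctx] by auto
  then have "0 \<le> real k * \<alpha> k * real n" "0 \<le> (\<Sum>j=k..d. \<alpha> j) * real n" by auto
  then show ?A using second_moment[OF ctx, of n] by (simp add: mult_ac)
  have "real k * \<alpha> k * real n \<le> min 1 (\<alpha> k * real d) * real n"
    "(\<Sum>j=k..d. \<alpha> j) * real n \<le> min 1 (\<alpha> k * real d) * real n"
    using tail_le_min[OF ctx] by (auto intro!: mult_right_mono simp del: min.bounded_iff)
  then have "42 * (real k * \<alpha> k * real n) + 42 * ((\<Sum>j=k..d. \<alpha> j) * real n)
      \<le> 84 * (min 1 (\<alpha> k * real d) * real n)" by linarith
  then show ?B by (simp only: mult_ac)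
qed

theorem mainTheorem2:
  shows
   "(\<forall>(d::nat) (\<alpha>::nat \<Rightarrow> real) (n::nat) (k::nat).
       prob_dist_sorted d \<alpha> \<and> k \<in> {1..d} \<longrightarrow>
       word_expect d \<alpha> n (\<lambda>w. (real (shRSK w k) - \<alpha> k * real n)^2)
         \<le> 42 * \<alpha> k * real k * real n + 42 * (\<Sum>j=k..d. \<alpha> j) * real n)
    \<and>
    (\<exists>C::real. \<forall>(d::nat) (\<alpha>::nat \<Rightarrow> real) (n::nat) (k::nat).
       prob_dist_sorted d \<alpha> \<and> k \<in> {1..d} \<longrightarrow>
       word_expect d \<alpha> n (\<lambda>w. (real (shRSK w k) - \<alpha> k * real n)^2)
         \<le> C * min 1 (\<alpha> k * real d) * real n)"
proof (intro conjI exI[of _ 84] allI impI; elim conjE)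
  fix d :: nat and \<alpha> :: "nat \<Rightarrow> real" and n k :: nat
  assume *: "prob_dist_sorted d \<alpha>" "k \<in> {1..d}"
  show first: "word_expect d \<alpha> n (\<lambda>w. (real (shRSK w k) - \<alpha> k * real n)^2)
         \<le> 42 * \<alpha> k * real k * real n + 42 * (\<Sum>j=k..d. \<alpha> j) * real n"
    by (rule SW_second_moment(1)[OF *])
  show "word_expect d \<alpha> n (\<lambda>w. (real (shRSK w k) - \<alpha> k * real n)^2)
         \<le> 84 * min 1 (\<alpha> k * real d) * real n"
    using first SW_second_moment(2)[OF *] by (rule order_trans)
qed

end
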